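(* Let $\mathcal{V}_1$ and $\mathcal{V}_2$ be matrix subspaces of $\mathbb{C}^{n\times n}$ over $\mathbb{C}$. Then the closure $\overline{\mathcal{V}_1\mathcal{V}_2}$ equals the linearization of $\mathcal{V}_1\mathcal{V}_2$ if and only if there exists $(V_1,V_2)\in\mathcal{V}_1\times\mathcal{V}_2$, at which the rank of $\Psi$ attains its maximum, such that the map $$Q_{(V_1,V_2)}(W_1,W_2)=2(I-\mathbf{P}_{V_1,V_2})(W_1W_2)$$ vanishes for all $(W_1,W_2)\in\mathcal{V}_1\times\mathcal{V}_2$.
   Context: A matrix subspace of $\mathbb{C}^{n\times n}$ over $\mathbb{C}$ is a $\mathbb{C}$-linear subspace. The set of products is $\mathcal{V}_1\mathcal{V}_2=\{V_1V_2 : V_1\in\mathcal{V}_1,\ V_2\in\mathcal{V}_2\}$. The linearization of $\mathcal{V}_1\mathcal{V}_2$ is the smallest matrix subspace (over $\mathbb{C}$) containing $\mathcal{V}_1\mathcal{V}_2$. Closures are in the standard topology. $\Psi:\mathcal{V}_1\times\mathcal{V}_2\to\mathbb{C}^{n\times n}$ is the bilinear map $\Psi(V_1,V_2)=V_1V_2$; the rank of $\Psi$ at $(V_1,V_2)$ is the dimension of the subspace $V_1\mathcal{V}_2+\mathcal{V}_1V_2=\{V_1W_2+W_1V_2 : W_1\in\mathcal{V}_1,\ W_2\in\mathcal{V}_2\}$ (the image of the derivative of $\Psi$ at $(V_1,V_2)$). $\mathbf{P}_{V_1,V_2}$ is the orthogonal projector on $\mathbb{C}^{n\times n}$ onto $V_1\mathcal{V}_2+\mathcal{V}_1V_2$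 with respect to the inner product $(A,B)=\mathrm{tr}(B^*A)$. *)

theory Defs
  imports "HOL-Analysis.Analysis"
begin

text \<open>
  The library vector space structure on \<open>complex^'n^'n\<close> is over the reals. Subspaces, spans and
  dimensions of matrices are taken here over the complex numbers (prefix \<open>cmat\<close>).
\<close>

definition cscale :: "complex \<Rightarrow> complex^'n^'n \<Rightarrow> complex^'n^'n"
  where "cscale c A = (\<chi> i j. c * A $ i $ j)"

global_interpretation cmat: vector_space "cscale :: complex \<Rightarrow> complex^'n^'n \<Rightarrow> complex^'n^'n"
  by standard (simp_all add: cscale_def vec_eq_iff algebra_simps)

definition set_of_products :: "(complex^'n^'n) set \<Rightarrow> (complex^'n^'n) set \<Rightarrow> (complex^'n^'n) set"
  where "set_of_products \<V>1 \<V>2 = {V1 ** V2 | V1 V2. V1 \<in> \<V>1 \<and> V2 \<in> \<V>2}"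

definition linearization :: "(complex^'n^'n) set \<Rightarrow> (complex^'n^'n) set"
  where "linearization S = cmat.subspace hull S"

lemma linearization_eq_span: "linearization S = cmat.span S"
  unfolding linearization_def
  by (rule hull_unique) (rule cmat.span_superset cmat.subspace_span cmat.span_minimal | assumption)+

text \<open>The image of the derivative of the product map at \<open>(V1, V2)\<close>.\<close>

definition deriv_image ::
  "(complex^'n^'n) set \<Rightarrow> (complex^'n^'n) set \<Rightarrow> complex^'n^'n \<Rightarrow> complex^'n^'n \<Rightarrow> (complex^'n^'n) set"
  where "deriv_image \<V>1 \<V>2 V1 V2 = {V1 ** W2 + W1 ** V2 | W1 W2. W1 \<in> \<V>1 \<and> W2 \<in> \<V>2}"

definition Psi_rank ::
  "(complex^'n^'n) set \<Rightarrow> (complex^'n^'n) set \<Rightarrow> complex^'n^'n \<Rightarrow> complex^'n^'n \<Rightarrow> nat"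
  where "Psi_rank \<V>1 \<V>2 V1 V2 = cmat.dim (deriv_image \<V>1 \<V>2 V1 V2)"

definition conj_transpose :: "complex^'n^'n \<Rightarrow> complex^'n^'n"
  where "conj_transpose A = (\<chi> i j. cnj (A $ j $ i))"

definition cmat_inner :: "complex^'n^'n \<Rightarrow> complex^'n^'n \<Rightarrow> complex"
  where "cmat_inner A B = trace (conj_transpose B ** A)"

text \<open>The definite description is well defined when \<open>S\<close> is a complex subspace, see
  \<open>orth_proj_exists_unique\<close> below; \<open>subspace_deriv_image\<close> covers its use in \<open>Q_map\<close>.\<close>

definition orth_proj :: "(complex^'n^'n) set \<Rightarrow> complex^'n^'n \<Rightarrow> complex^'n^'n"
  where "orth_proj S A = (THE P. P \<in> S \<and> (\<forall>B\<in>S. cmat_inner (A - P) B = 0))"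

definition Q_map ::
  "(complex^'n^'n) set \<Rightarrow> (complex^'n^'n) set \<Rightarrow> complex^'n^'n \<Rightarrow> complex^'n^'n
    \<Rightarrow> complex^'n^'n \<Rightarrow> complex^'n^'n \<Rightarrow> complex^'n^'n"
  where "Q_map \<V>1 \<V>2 V1 V2 W1 W2 =
    cscale 2 (W1 ** W2 - orth_proj (deriv_image \<V>1 \<V>2 V1 V2) (W1 ** W2))"

lemma Re_cmat_inner: "Re (cmat_inner A B) = A \<bullet> B"
proof -
  have "Re (cmat_inner A B) = (\<Sum>j\<in>UNIV. \<Sum>i\<in>UNIV. A $ i $ j \<bullet> B $ i $ j)"
    by (simp add: cmat_inner_def trace_def conj_transpose_def matrix_matrix_mult_def
        inner_complex_def mult.commute)
  also have "\<dots> = A \<bullet> B"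
    by (subst sum.swap) (simp add: inner_vec_def)
  finally show ?thesis .
qed

lemma cmat_inner_cscale_right: "cmat_inner A (cscale c B) = cnj c * cmat_inner A B"
  by (simp add: cmat_inner_def trace_def conj_transpose_def matrix_matrix_mult_def cscale_def
      sum_distrib_left mult.assoc)

lemma orth_proj_exists_unique:
  fixes S :: "(complex^'n^'n) set"
  assumes S: "cmat.subspace S"
  shows "\<exists>!P. P \<in> S \<and> (\<forall>B\<in>S. cmat_inner (A - P) B = 0)"
proof -
  have scaleR: "r *\<^sub>R B = cscale (of_real r) B" for r and B :: "complex^'n^'n"
    by (simp add: cscale_def vec_eq_iff complex_eq_iff)
  have rS: "subspace S"
    unfolding subspace_def scaleR
    by (intro conjI ballI allI cmat.subspace_0[OF S] cmat.subspace_add[OF S] cmat.subspace_scale[OF S])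
  have eq0: "(\<forall>B\<in>S. cmat_inner C B = 0) \<longleftrightarrow> (\<forall>B\<in>S. C \<bullet> B = 0)" for C
  proof (intro iffI ballI)
    fix B assume "\<forall>B\<in>S. cmat_inner C B = 0" "B \<in> S"
    then have "Re (cmat_inner C B) = 0" by simp
    then show "C \<bullet> B = 0" by (simp only: Re_cmat_inner)
  next
    fix B assume *: "\<forall>B\<in>S. C \<bullet> B = 0" "B \<in> S"
    have "cscale \<i> B \<in> S" using S * by (simp add: cmat.subspace_scale)
    then have "Re (cmat_inner C (cscale \<i> B)) = 0" "Re (cmat_inner C B) = 0"
      using * by (simp_all add: Re_cmat_inner)
    then show "cmat_inner C B = 0"
      by (simp add: cmat_inner_cscale_right complex_eq_iff)
  qed
  obtain P Z where P: "P \<in> span S" "\<And>B. B \<in> span S \<Longrightarrow> orthogonal Z B" "A = P + Z"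
    using orthogonal_subspace_decomp_exists[of S A] by blast
  have sp: "span S = S" using rS by (simp add: span_eq_iff)
  show ?thesis
    unfolding eq0
  proof (intro ex1I[of _ P] conjI ballI)
    show "P \<in> S" using P sp by simp
    show "(A - P) \<bullet> B = 0" if "B \<in> S" for B
      using P that sp by (simp add: orthogonal_def)
  next
    fix P' assume P': "P' \<in> S \<and> (\<forall>B\<in>S. (A - P') \<bullet> B = 0)"
    have D: "P - P' \<in> S" using P P' sp rS by (simp add: subspace_diff)
    have "(A - P') \<bullet> (P - P') = 0" "Z \<bullet> (P - P') = 0"
      using D P P' sp by (auto simp: orthogonal_def)
    then have "(P - P') \<bullet> (P - P') = 0"
      using P(3) by (simp add: inner_diff_left inner_add_left)
    then show "P' = P" by simp
  qed
qed

lemma subspace_deriv_image: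
  fixes \<V>1 \<V>2 :: "(complex^'n^'n) set"
  assumes 1: "cmat.subspace \<V>1" and 2: "cmat.subspace \<V>2"
  shows "cmat.subspace (deriv_image \<V>1 \<V>2 V1 V2)"
proof -
  have scale: "cscale c (V1 ** W2 + W1 ** V2) = V1 ** cscale c W2 + cscale c W1 ** V2" for c W1 W2
    by (simp add: cscale_def vec_eq_iff matrix_matrix_mult_def sum_distrib_left distrib_left
        mult.assoc mult.left_commute)
  have add: "(V1 ** W2 + W1 ** V2) + (V1 ** X2 + X1 ** V2) = V1 ** (W2 + X2) + (W1 + X1) ** V2"
    for W1 W2 X1 X2
    by (simp add: vec_eq_iff matrix_matrix_mult_def sum.distrib algebra_simps)
  have zero: "V1 ** 0 + 0 ** V2 = 0"
    by (simp add: vec_eq_iff matrix_matrix_mult_def)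
  show ?thesis
  proof (rule cmat.subspaceI)
    show "0 \<in> deriv_image \<V>1 \<V>2 V1 V2"
      unfolding deriv_image_def mem_Collect_eq
      using zero[symmetric] cmat.subspace_0[OF 1] cmat.subspace_0[OF 2] by blast
  next
    fix x y assume "x \<in> deriv_image \<V>1 \<V>2 V1 V2" "y \<in> deriv_image \<V>1 \<V>2 V1 V2"
    then show "x + y \<in> deriv_image \<V>1 \<V>2 V1 V2"
      unfolding deriv_image_def mem_Collect_eq
      using add cmat.subspace_add[OF 1] cmat.subspace_add[OF 2] by (elim exE conjE) blast
  next
    fix c x assume "x \<in> deriv_image \<V>1 \<V>2 V1 V2"
    then show "cscale c x \<in> deriv_image \<V>1 \<V>2 V1 V2"
      unfolding deriv_image_def mem_Collect_eq
      using scale cmat.subspace_scale[OF 1] cmat.subspace_scale[OF 2] by (elim exE conjE) blast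
  qed
qed

end

theory Submission
  imports Defs "HOL-Library.Function_Algebras"
begin

text \<open>
  Since \<open>V1 \<V>2 + \<V>1 V2\<close> always lies in the linearization \<open>L\<close> of the products, and since \<open>Q\<close> vanishes
  at \<open>(V1, V2)\<close> exactly if this subspace contains all products, the right-hand side says that
  the derivative of the product map at some point has image \<open>L\<close>; the rank is then automatically
  maximal. On the left-hand side, the closure of the products is contained in \<open>L\<close>, so the condition is
  that the product map has dense range in \<open>L\<close>. The theorem is therefore an instance of a fact
  about complex polynomial maps \<open>F\<close>, \<open>dense_range_iff_surjective_derivative\<close>: the range is dense if and
  only if the derivative is surjective somewhere.

  If the range is dense, the components of \<open>F\<close> are algebraically independent. Together with suitable
  coordinates of the domain they form a transcendence basis, over which the other coordinates are
  algebraic and, in characteristic zero, separable. Differentiating the minimal relations shows that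
  at a generic point the differentials of the transcendence basis are a basis of the dual space; so
  those of the components of \<open>F\<close> are linearly independent (\<open>exists_surjective_derivative\<close>).

  Conversely, if the derivative is surjective at a point, restriction to an affine slice reduces to
  equal dimensions (\<open>dense_range_of_surjective_derivative\<close>). Then the coordinates and the Jacobian
  determinant are algebraic over the components of \<open>F\<close>. Away from the zeros of certain coefficients of
  these relations, the noncritical points have an image that is open, because the derivative is
  invertible there, and closed, by properness. Complex lines minus finite sets are connected, so the
  image contains everything outside a hypersurface (\<open>dense_range_square\<close>).

  Both directions draw their algebraic relations from one dimension count,
  \<open>exists_polynomial_relation\<close>: more than \<open>m\<close> polynomials in \<open>m\<close> variables are algebraically dependent.
\<close>

section \<open>Polynomial functions\<close>

text \<open>
  Polynomials enter only as functions. The generators \<open>G\<close> are arbitrary functions, so that the same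
  notion serves for polynomials in coordinates and for polynomials in the components of a polynomial
  map. The number \<open>n\<close> bounds a degree from above; it is not the degree.
\<close>

inductive poly_deg_le :: "('p \<Rightarrow> complex) set \<Rightarrow> nat \<Rightarrow> ('p \<Rightarrow> complex) \<Rightarrow> bool" for G where
  const: "poly_deg_le G n (\<lambda>_. c)"
| gen: "g \<in> G \<Longrightarrow> poly_deg_le G (Suc n) g"
| add: "poly_deg_le G n f \<Longrightarrow> poly_deg_le G n g \<Longrightarrow> poly_deg_le G n (\<lambda>p. f p + g p)"
| mult: "poly_deg_le G m f \<Longrightarrow> poly_deg_le G n g \<Longrightarrow> poly_deg_le G (m + n) (\<lambda>p. f p * g p)"

lemma poly_deg_le_mono:
  assumes "poly_deg_le G m f" "m \<le> n" shows "poly_deg_le G n f"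
  using poly_deg_le.mult[OF assms(1) poly_deg_le.const[of G "n - m" 1]] assms(2) by simp

lemma poly_deg_le_prod:
  assumes "\<And>i. i \<in> S \<Longrightarrow> poly_deg_le G d (f i)"
  shows "poly_deg_le G (card S * d) (\<lambda>p. \<Prod>i\<in>S. f i p)"
proof (cases "finite S")
  case True
  then show ?thesis using assms
    by (induction S) (auto intro: poly_deg_le.intros)
qed (auto intro: poly_deg_le.intros)

definition poly_alg :: "('p \<Rightarrow> complex) set \<Rightarrow> ('p \<Rightarrow> complex) \<Rightarrow> bool"
  where "poly_alg G f \<longleftrightarrow> (\<exists>n. poly_deg_le G n f)"

lemma poly_alg_const: "poly_alg G (\<lambda>_. c)"
  unfolding poly_alg_def by (blast intro: poly_deg_le.const)

lemma poly_alg_gen: "g \<in> G \<Longrightarrow> poly_alg G g"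
  unfolding poly_alg_def by (blast intro: poly_deg_le.gen)

lemma poly_alg_add: "poly_alg G f \<Longrightarrow> poly_alg G g \<Longrightarrow> poly_alg G (\<lambda>p. f p + g p)"
  unfolding poly_alg_def
proof (elim exE)
  fix m n assume "poly_deg_le G m f" "poly_deg_le G n g"
  then have "poly_deg_le G (max m n) f" "poly_deg_le G (max m n) g" by (auto intro: poly_deg_le_mono)
  then show "\<exists>n. poly_deg_le G n (\<lambda>p. f p + g p)" by (blast intro: poly_deg_le.add)
qed

lemma poly_alg_mult: "poly_alg G f \<Longrightarrow> poly_alg G g \<Longrightarrow> poly_alg G (\<lambda>p. f p * g p)"
  unfolding poly_alg_def by (blast intro: poly_deg_le.mult)

lemma poly_alg_diff:
  assumes "poly_alg G f" "poly_alg G g" shows "poly_alg G (\<lambda>p. f p - g p)"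
  using poly_alg_add[OF assms(1) poly_alg_mult[OF poly_alg_const[of G "-1"] assms(2)]] by simp

lemma poly_alg_sum:
  assumes "\<And>i. i \<in> S \<Longrightarrow> poly_alg G (f i)" shows "poly_alg G (\<lambda>p. \<Sum>i\<in>S. f i p)"
  using assms by (induction S rule: infinite_finite_induct) (auto intro: poly_alg_const poly_alg_add)

lemma poly_alg_prod:
  assumes "\<And>i. i \<in> S \<Longrightarrow> poly_alg G (f i)" shows "poly_alg G (\<lambda>p. \<Prod>i\<in>S. f i p)"
  using assms by (induction S rule: infinite_finite_induct) (auto intro: poly_alg_const poly_alg_mult)

lemma poly_alg_power: "poly_alg G f \<Longrightarrow> poly_alg G (\<lambda>p. f p ^ n)"
  by (induction n) (auto intro: poly_alg_const poly_alg_mult)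

lemmas poly_alg_intros = poly_alg_const poly_alg_add poly_alg_mult poly_alg_diff
  poly_alg_sum poly_alg_prod poly_alg_power

text \<open>
  The degree bound only matters for counting; elsewhere induction proceeds over the generated algebra.
\<close>

lemma poly_alg_induct [consumes 1, case_names const gen add mult]:
  assumes "poly_alg G f"
    and "\<And>c. P (\<lambda>_. c)" and "\<And>g. g \<in> G \<Longrightarrow> P g"
    and "\<And>f g. poly_alg G f \<Longrightarrow> poly_alg G g \<Longrightarrow> P f \<Longrightarrow> P g \<Longrightarrow> P (\<lambda>p. f p + g p)"
    and "\<And>f g. poly_alg G f \<Longrightarrow> poly_alg G g \<Longrightarrow> P f \<Longrightarrow> P g \<Longrightarrow> P (\<lambda>p. f p * g p)"
  shows "P f"
proof -
  obtain n where "poly_deg_le G n f" using assms(1) by (auto simp: poly_alg_def)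
  then show ?thesis
  proof (induction)
    case (add n f g)
    then show ?case using assms(4)[of f g] by (auto simp: poly_alg_def)
  next
    case (mult m f n g)
    then show ?case using assms(5)[of f g] by (auto simp: poly_alg_def)
  qed (auto intro: assms(2,3))
qed

lemma poly_alg_trans:
  assumes "poly_alg G f" "\<And>g. g \<in> G \<Longrightarrow> poly_alg H g" shows "poly_alg H f"
  using assms(1) by (induction rule: poly_alg_induct) (auto intro: poly_alg_intros assms(2))

text \<open>
  Formal polynomials in variables indexed by \<open>I\<close> are represented by the functions that they define on
  \<open>'i \<Rightarrow> complex\<close>. Nothing is lost, since \<open>\<complex>\<close> is infinite, and the index set may be any set: no
  type has to be found for each number of variables.
\<close>

abbreviation coords :: "'i set \<Rightarrow> (('i \<Rightarrow> complex) \<Rightarrow> complex) set"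
  where "coords I \<equiv> (\<lambda>i z. z i) ` I"

lemma poly_alg_compose:
  assumes "poly_alg (coords I) P" and "\<And>i. i \<in> I \<Longrightarrow> poly_alg H (g i)"
  shows "poly_alg H (\<lambda>p. P (\<lambda>i. g i p))"
  using assms(1) by (induction rule: poly_alg_induct) (auto intro: poly_alg_intros assms(2))

lemma poly_alg_coords_cong:
  assumes "poly_alg (coords I) P" and "\<And>i. i \<in> I \<Longrightarrow> y i = z i"
  shows "P y = P z"
  using assms(1) by (induction rule: poly_alg_induct) (auto simp: assms(2))

section \<open>More polynomials than variables satisfy a relation\<close>

global_interpretation cfun: vector_space "\<lambda>(c::complex) (f :: 'p \<Rightarrow> complex) p. c * f p"
  by standard (auto simp: fun_eq_iff algebra_simps)

lemma cfun_sum_apply: "(\<Sum>a\<in>A. f a) p = (\<Sum>a\<in>A. f a p)" for f :: "'a \<Rightarrow> 'p \<Rightarrow> complex"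
  by (induction A rule: infinite_finite_induct) auto

definition monomials :: "('p \<Rightarrow> complex) set \<Rightarrow> nat \<Rightarrow> ('p \<Rightarrow> complex) set"
  where "monomials K n = (\<lambda>\<alpha> p. \<Prod>g\<in>K. g p ^ \<alpha> g) ` (K \<rightarrow>\<^sub>E {..n})"

lemma finite_monomials: "finite K \<Longrightarrow> finite (monomials K n)"
  by (simp add: monomials_def finite_PiE)

lemma card_monomials: "finite K \<Longrightarrow> card (monomials K n) \<le> (n + 1) ^ card K"
  unfolding monomials_def
  by (rule order.trans[OF card_image_le]) (simp_all add: finite_PiE card_PiE)

lemma monomialsI:
  assumes "\<And>g. g \<in> K \<Longrightarrow> \<alpha> g \<le> n" shows "(\<lambda>p. \<Prod>g\<in>K. g p ^ \<alpha> g) \<in> monomials K n"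
proof -
  have "(\<lambda>p. \<Prod>g\<in>K. g p ^ \<alpha> g) = (\<lambda>p. \<Prod>g\<in>K. g p ^ (restrict \<alpha> K) g)" by simp
  moreover have "restrict \<alpha> K \<in> K \<rightarrow>\<^sub>E {..n}" using assms by auto
  ultimately show ?thesis unfolding monomials_def by blast
qed

lemma cfun_span_mult:
  assumes f: "f \<in> cfun.span A" and g: "g \<in> cfun.span B"
    and AB: "\<And>a b. a \<in> A \<Longrightarrow> b \<in> B \<Longrightarrow> (\<lambda>p. a p * b p) \<in> cfun.span C"
  shows "(\<lambda>p. f p * g p) \<in> cfun.span C"
proof -
  have *: "(\<lambda>p. a p * g p) \<in> cfun.span C" if a: "a \<in> A" for a
    using g
  proof (induction rule: cfun.span_induct_alt)
    case base
    then show ?case using cfun.span_zero[of C] by (simp add: zero_fun_def)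
  next
    case (step c x y)
    have "(\<lambda>p. c * (a p * x p)) + (\<lambda>p. a p * y p) \<in> cfun.span C"
      using AB[OF a step(1)] step(2) by (intro cfun.span_add cfun.span_scale)
    then show ?case by (simp add: plus_fun_def algebra_simps)
  qed
  show ?thesis
    using f
  proof (induction rule: cfun.span_induct_alt)
    case base
    then show ?case using cfun.span_zero[of C] by (simp add: zero_fun_def)
  next
    case (step c x y)
    have "(\<lambda>p. c * (x p * g p)) + (\<lambda>p. y p * g p) \<in> cfun.span C"
      using *[OF step(1)] step(2) by (intro cfun.span_add cfun.span_scale)
    then show ?case by (simp add: plus_fun_def algebra_simps)
  qed
qed

text \<open>
  The exponents of the monomials range over a box, not a simplex. This makes the dimension bound
  \<open>(n + 1) ^ card K\<close> immediate, and the crude bound suffices for counting.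
\<close>

lemma poly_deg_le_in_span_monomials:
  assumes K: "finite K" and "poly_deg_le K n f"
  shows "f \<in> cfun.span (monomials K n)"
  using assms(2)
proof (induction)
  case (const n c)
  have "(\<lambda>p. \<Prod>g\<in>K. g p ^ 0) \<in> monomials K n" by (rule monomialsI) simp
  then have "(\<lambda>_. 1) \<in> cfun.span (monomials K n)" by (auto intro: cfun.span_base)
  then show ?case using cfun.span_scale[of "\<lambda>_. 1" "monomials K n" c] by simp
next
  case (gen g n)
  have "(\<lambda>p. \<Prod>h\<in>K. h p ^ (if h = g then 1 else 0)) \<in> monomials K (Suc n)" by (rule monomialsI) simp
  moreover have "(\<Prod>h\<in>K. h p ^ (if h = g then 1 else 0)) = g p" for p
  proof -
    have "(\<Prod>h\<in>K. h p ^ (if h = g then 1 else 0)) = (\<Prod>h\<in>K. if h = g then h p else 1)"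
      by (rule prod.cong) auto
    then show ?thesis using K gen by (simp add: prod.delta)
  qed
  ultimately show ?case by (auto intro: cfun.span_base)
next
  case (add n f g)
  then show ?case using cfun.span_add[of f "monomials K n" g] by (simp add: plus_fun_def)
next
  case (mult m f n g)
  have "(\<lambda>p. a p * b p) \<in> cfun.span (monomials K (m + n))"
    if a: "a \<in> monomials K m" and b: "b \<in> monomials K n" for a b
  proof -
    obtain \<alpha> \<beta> where \<alpha>: "\<alpha> \<in> K \<rightarrow>\<^sub>E {..m}" "a = (\<lambda>p. \<Prod>g\<in>K. g p ^ \<alpha> g)"
      and \<beta>: "\<beta> \<in> K \<rightarrow>\<^sub>E {..n}" "b = (\<lambda>p. \<Prod>g\<in>K. g p ^ \<beta> g)"
      using a b by (auto simp: monomials_def)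
    have "(\<lambda>p. \<Prod>g\<in>K. g p ^ (\<alpha> g + \<beta> g)) \<in> monomials K (m + n)"
      using \<alpha>(1) \<beta>(1) by (intro monomialsI add_mono) auto
    then show ?thesis
      by (auto simp: \<alpha>(2) \<beta>(2) power_add prod.distrib intro: cfun.span_base)
  qed
  then show ?case by (rule cfun_span_mult[OF mult.IH])
qed

text \<open>
  The relation is indexed by \<open>A\<close> and not by the image \<open>v ` A\<close>, so that repeated values of \<open>v\<close> also give
  a nontrivial relation.
\<close>

lemma exists_linear_relation:
  fixes v :: "'a \<Rightarrow> 'p \<Rightarrow> complex"
  assumes A: "finite A" and B: "finite B" "card B < card A" and v: "v ` A \<subseteq> cfun.span B"
  shows "\<exists>c. (\<exists>a\<in>A. c a \<noteq> 0) \<and> (\<forall>p. (\<Sum>a\<in>A. c a * v a p) = 0)"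
proof (cases "inj_on v A")
  case True
  have "\<not> cfun.independent (v ` A)"
  proof
    assume "cfun.independent (v ` A)"
    then have "card (v ` A) \<le> card B" using cfun.independent_span_bound[OF B(1) _ v] by simp
    then show False using True B(2) by (simp add: card_image)
  qed
  then obtain u where u: "\<exists>w\<in>v ` A. u w \<noteq> 0" "(\<Sum>w\<in>v ` A. (\<lambda>p. u w * w p)) = 0"
    using cfun.dependent_finite[of "v ` A"] A by auto
  have "(\<Sum>a\<in>A. u (v a) * v a p) = 0" for p
    using fun_cong[OF u(2), of p] True by (simp add: cfun_sum_apply sum.reindex)
  then show ?thesis using u(1) by (intro exI[of _ "u \<circ> v"]) auto
next
  case False
  then obtain a b where ab: "a \<in> A" "b \<in> A" "a \<noteq> b" "v a = v b" by (auto simp: inj_on_def)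
  let ?c = "\<lambda>x. if x = a then 1 else if x = b then - 1 else (0::complex)"
  have "(\<Sum>x\<in>A. ?c x * v x p) = 0" for p
  proof -
    have "(\<Sum>x\<in>A. ?c x * v x p) = (\<Sum>x\<in>A. (if x = a then v x p else 0) - (if x = b then v x p else 0))"
      using ab(3) by (intro sum.cong) auto
    also have "\<dots> = v a p - v b p" using A ab by (simp add: sum_subtractf sum.delta)
    finally show ?thesis using ab(4) by simp
  qed
  then show ?thesis using ab(1) by (intro exI[of _ ?c]) auto
qed

text \<open>
  A dimension count. Polynomials \<open>P\<close> with exponents at most \<open>N\<close> in \<open>s = card I\<close> variables form a space of
  dimension \<open>(N + 1) ^ s\<close>, whereas the composites \<open>P \<circ> g\<close> are polynomials of degree \<open>O(N)\<close> in \<open>K\<close> and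
  hence lie in a space of dimension \<open>O(N ^ card K)\<close>. For large \<open>N\<close> two different \<open>P\<close> have the same
  composite.

  The space of the \<open>P\<close> is spanned here by the functions \<open>\<delta> \<beta>\<close>, for grid points \<open>\<beta> \<in> {0..N} ^ I\<close>, which
  vanish at all grid points except \<open>\<beta>\<close>. Evaluation at the grid shows at once that a nontrivial
  combination of them is a nonzero function; for monomials this would need a separate argument.
\<close>

lemma exists_polynomial_relation:
  fixes g :: "'i \<Rightarrow> 'p \<Rightarrow> complex"
  assumes I: "finite I" and K: "finite K" "card K < card I"
    and g: "\<And>i. i \<in> I \<Longrightarrow> poly_alg K (g i)"
  shows "\<exists>P. poly_alg (coords I) P \<and> (\<exists>z. P z \<noteq> 0) \<and> (\<forall>p. P (\<lambda>i. g i p) = 0)"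
proof -
  have "\<exists>e. \<forall>i\<in>I. poly_deg_le K (e i) (g i)" using g by (auto simp: poly_alg_def intro!: bchoice)
  then obtain e where e: "\<And>i. i \<in> I \<Longrightarrow> poly_deg_le K (e i) (g i)" by auto
  define D where "D = Max (insert 0 (e ` I))"
  have D: "poly_deg_le K D (g i)" if "i \<in> I" for i
    using poly_deg_le_mono[OF e[OF that]] I that by (simp add: D_def)
  define s where "s = card I"
  \<comment> \<open>Chosen such that \<open>((s * D + 1) * (N + 1)) ^ card K < (N + 1) ^ s\<close>.\<close>
  define N where "N = (s * D + 1) ^ card K"
  define n where "n = s * (N * D)"
  define A where "A = I \<rightarrow>\<^sub>E {..N}"
  define \<delta> where "\<delta> \<beta> z = (\<Prod>i\<in>I. \<Prod>a\<in>{..N} - {\<beta> i}. z i - of_nat a)" for \<beta> and z :: "'i \<Rightarrow> complex"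
  have A: "finite A" "card A = (N + 1) ^ s"
    using I by (simp_all add: A_def s_def finite_PiE card_PiE)
  have \<delta>_alg: "poly_alg (coords I) (\<delta> \<beta>)" for \<beta>
    unfolding \<delta>_def by (intro poly_alg_intros poly_alg_gen) auto
  have \<delta>_fun: "poly_deg_le K n (\<lambda>p. \<delta> \<beta> (\<lambda>i. g i p))" if \<beta>: "\<beta> \<in> A" for \<beta>
    unfolding \<delta>_def n_def s_def
  proof (rule poly_deg_le_prod)
    fix i assume i: "i \<in> I"
    have "\<beta> i \<in> {..N}" using \<beta> i by (auto simp: A_def)
    then have "card ({..N} - {\<beta> i}) = N" by simp
    moreover have "poly_deg_le K D (\<lambda>p. g i p - of_nat a)" for a
      using poly_deg_le.add[OF D[OF i] poly_deg_le.const[of K D "- of_nat a"]] by simp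
    ultimately show "poly_deg_le K (N * D) (\<lambda>p. \<Prod>a\<in>{..N} - {\<beta> i}. g i p - of_nat a)"
      using poly_deg_le_prod[of "{..N} - {\<beta> i}" K D "\<lambda>a p. g i p - of_nat a"] by simp
  qed
  have "(n + 1) ^ card K \<le> ((s * D + 1) * (N + 1)) ^ card K"
    by (rule power_mono) (simp_all add: n_def algebra_simps)
  also have "\<dots> = N * (N + 1) ^ card K" by (simp only: power_mult_distrib N_def)
  also have "\<dots> < (N + 1) ^ Suc (card K)" by simp
  also have "\<dots> \<le> (N + 1) ^ s" using K(2) by (intro power_increasing) (simp_all add: s_def)
  finally have "card (monomials K n) < card A" using card_monomials[OF K(1), of n] A(2) by simp
  then obtain c where c: "\<exists>\<beta>\<in>A. c \<beta> \<noteq> 0" "\<And>p. (\<Sum>\<beta>\<in>A. c \<beta> * \<delta> \<beta> (\<lambda>i. g i p)) = 0"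
    using exists_linear_relation[OF A(1) finite_monomials[OF K(1)], of n "\<lambda>\<beta> p. \<delta> \<beta> (\<lambda>i. g i p)"]
      poly_deg_le_in_span_monomials[OF K(1) \<delta>_fun] by blast
  obtain \<gamma> where \<gamma>: "\<gamma> \<in> A" "c \<gamma> \<noteq> 0" using c(1) by auto
  have zero: "\<delta> \<beta> (\<lambda>i. of_nat (\<gamma> i)) = 0" if \<beta>: "\<beta> \<in> A" "\<beta> \<noteq> \<gamma>" for \<beta>
  proof -
    obtain i where i: "i \<in> I" "\<beta> i \<noteq> \<gamma> i"
      using \<beta> \<gamma>(1) PiE_ext[of \<beta> I "\<lambda>_. {..N}" \<gamma>] by (auto simp: A_def)
    then have "\<gamma> i \<in> {..N} - {\<beta> i}" using \<gamma>(1) by (auto simp: A_def)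
    then have "(\<Prod>a\<in>{..N} - {\<beta> i}. of_nat (\<gamma> i) - of_nat a :: complex) = 0"
      by (intro prod_zero) auto
    then show ?thesis unfolding \<delta>_def using I i(1) by (intro prod_zero) auto
  qed
  have "(\<Sum>\<beta>\<in>A. c \<beta> * \<delta> \<beta> (\<lambda>i. of_nat (\<gamma> i))) = c \<gamma> * \<delta> \<gamma> (\<lambda>i. of_nat (\<gamma> i))"
    using A(1) \<gamma>(1) zero by (subst sum.remove[of _ \<gamma>]) (auto intro: sum.neutral)
  also have "\<dots> \<noteq> 0" using \<gamma>(2) I by (simp add: \<delta>_def)
  finally show ?thesis
    using c(2) by (intro exI[of _ "\<lambda>z. \<Sum>\<beta>\<in>A. c \<beta> * \<delta> \<beta> z"])
      (auto intro!: poly_alg_intros \<delta>_alg)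
qed

section \<open>Relations as polynomials in one distinguished variable\<close>

lemma poly_alg_split_variable:
  assumes "poly_alg (coords (insert t I)) P"
  shows "\<exists>d C. (\<forall>j. poly_alg (coords I) (C j)) \<and> (\<forall>z. P z = (\<Sum>j\<le>d::nat. C j z * z t ^ j))"
  using assms
proof (induction rule: poly_alg_induct)
  case (const c)
  show ?case by (intro exI[of _ 0] exI[of _ "\<lambda>_ _. c"]) (simp add: poly_alg_const)
next
  case (gen g)
  then consider "g = (\<lambda>z. z t)" | i where "i \<in> I" "g = (\<lambda>z. z i)" by auto
  then show ?case
  proof cases
    case 1
    then show ?thesis
      by (intro exI[of _ 1] exI[of _ "\<lambda>j _. of_nat j"]) (simp add: poly_alg_const)
  next
    case 2
    then show ?thesis by (intro exI[of _ 0] exI[of _ "\<lambda>_. g"]) (simp add: poly_alg_gen)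
  qed
next
  case (add f g)
  then obtain d C e E where C: "\<And>j. poly_alg (coords I) (C j)" "\<And>z. f z = (\<Sum>j\<le>d::nat. C j z * z t ^ j)"
    and E: "\<And>j. poly_alg (coords I) (E j)" "\<And>z. g z = (\<Sum>j\<le>e::nat. E j z * z t ^ j)" by blast
  have "(\<Sum>j\<le>d. C j z * z t ^ j) = (\<Sum>j\<le>max d e. (if j \<le> d then C j z else 0) * z t ^ j)" for z
    by (intro sum.mono_neutral_cong_left) auto
  moreover have "(\<Sum>j\<le>e. E j z * z t ^ j) = (\<Sum>j\<le>max d e. (if j \<le> e then E j z else 0) * z t ^ j)" for z
    by (intro sum.mono_neutral_cong_left) auto
  moreover have "poly_alg (coords I) (\<lambda>z. (if j \<le> d then C j z else 0) + (if j \<le> e then E j z else 0))" for j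
    using C(1) E(1) by (cases "j \<le> d"; cases "j \<le> e") (auto intro: poly_alg_intros)
  ultimately show ?case
    using C E by (intro exI[of _ "max d e"]
        exI[of _ "\<lambda>j z. (if j \<le> d then C j z else 0) + (if j \<le> e then E j z else 0)"])
      (simp add: sum.distrib distrib_right)
next
  case (mult f g)
  then obtain d C e E where C: "\<And>j. poly_alg (coords I) (C j)" "\<And>z. f z = (\<Sum>j\<le>d::nat. C j z * z t ^ j)"
    and E: "\<And>j. poly_alg (coords I) (E j)" "\<And>z. g z = (\<Sum>j\<le>e::nat. E j z * z t ^ j)" by blast
  define H where "H k z = (\<Sum>(i,j)\<in>{(i,j). i \<le> d \<and> j \<le> e \<and> i + j = k}. C i z * E j z)" for k z
  have H: "poly_alg (coords I) (H k)" for k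
    unfolding H_def using C(1) E(1) by (auto simp: split_beta intro!: poly_alg_intros)
  have "f z * g z = (\<Sum>k\<le>d + e. H k z * z t ^ k)" for z
  proof -
    have "f z * g z = (\<Sum>(i,j)\<in>{..d} \<times> {..e}. C i z * E j z * z t ^ (i + j))"
      by (simp add: C E sum_product sum.cartesian_product power_add mult_ac)
    also have "\<dots> = (\<Sum>k\<le>d + e. \<Sum>p\<in>{p \<in> {..d} \<times> {..e}. fst p + snd p = k}.
        (case p of (i,j) \<Rightarrow> C i z * E j z * z t ^ (i + j)))"
      by (rule sum.group[symmetric]) auto
    also have "\<dots> = (\<Sum>k\<le>d + e. H k z * z t ^ k)"
      unfolding H_def sum_distrib_right
      by (intro sum.cong) auto
    finally show ?thesis .
  qed
  then show ?case using H by blast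
qed

section \<open>Polynomial functions on a complex coordinate space\<close>

abbreviation vcoords :: "(complex^'a \<Rightarrow> complex) set"
  where "vcoords \<equiv> range (\<lambda>i x. x $ i)"

lemma card_vcoords: "card (vcoords :: (complex^'a \<Rightarrow> complex) set) \<le> CARD('a)"
  by (rule card_image_le) simp

lemma poly_alg_vcoord: "poly_alg vcoords (\<lambda>x. x $ i)"
  by (rule poly_alg_gen) simp

lemma poly_alg_vcompose:
  fixes h :: "'p \<Rightarrow> complex^'a"
  assumes "poly_alg vcoords f" and "\<And>i. poly_alg H (\<lambda>p. h p $ i)"
  shows "poly_alg H (\<lambda>p. f (h p))"
  using assms(1) by (induction rule: poly_alg_induct) (auto intro: poly_alg_intros assms(2))

lemma poly_alg_on_line:
  fixes f :: "complex^'a \<Rightarrow> complex"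
  assumes "poly_alg vcoords f"
  shows "\<exists>q. \<forall>t. f (x + t *s v) = poly q t"
  using assms
proof (induction rule: poly_alg_induct)
  case (const c)
  show ?case by (intro exI[of _ "[:c:]"]) simp
next
  case (gen g)
  then obtain i where "g = (\<lambda>x. x $ i)" by auto
  then show ?case by (intro exI[of _ "[:x $ i, v $ i:]"]) simp
next
  case (add f g)
  then show ?case by (metis poly_add)
next
  case (mult f g)
  then show ?case by (metis poly_mult)
qed

lemma has_derivative_poly_alg:
  fixes f :: "complex^'a \<Rightarrow> complex"
  assumes "poly_alg vcoords f"
  shows "\<exists>d. (\<forall>i. poly_alg vcoords (d i)) \<and>
    (\<forall>x. (f has_derivative (\<lambda>v. \<Sum>i\<in>UNIV. d i x * v $ i)) (at x))"
  using assms
proof (induction rule: poly_alg_induct)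
  case (const c)
  show ?case by (intro exI[of _ "\<lambda>_ _. 0"]) (simp add: poly_alg_const)
next
  case (gen g)
  then obtain k where k: "g = (\<lambda>x. x $ k)" by auto
  have "(\<Sum>i\<in>UNIV. (if i = k then 1 else 0) * v $ i) = v $ k" for v :: "complex^'a"
    by (simp add: if_distrib[of "\<lambda>c. c * _"] cong: if_cong)
  then show ?case unfolding k
    by (intro exI[of _ "\<lambda>i _. if i = k then 1 else 0"])
      (simp add: poly_alg_const bounded_linear_imp_has_derivative[OF bounded_linear_vec_nth])
next
  case (add f g)
  then obtain d e where d: "\<And>i. poly_alg vcoords (d i)"
      "\<And>x. (f has_derivative (\<lambda>v. \<Sum>i\<in>UNIV. d i x * v $ i)) (at x)"
    and e: "\<And>i. poly_alg vcoords (e i)"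
      "\<And>x. (g has_derivative (\<lambda>v. \<Sum>i\<in>UNIV. e i x * v $ i)) (at x)" by blast
  have "((\<lambda>x. f x + g x) has_derivative (\<lambda>v. \<Sum>i\<in>UNIV. (d i x + e i x) * v $ i)) (at x)" for x
    by (rule has_derivative_eq_rhs[OF has_derivative_add[OF d(2) e(2)]])
      (simp add: sum.distrib distrib_right)
  then show ?case using d(1) e(1)
    by (intro exI[of _ "\<lambda>i x. d i x + e i x"]) (auto intro: poly_alg_intros)
next
  case (mult f g)
  then obtain d e where d: "\<And>i. poly_alg vcoords (d i)"
      "\<And>x. (f has_derivative (\<lambda>v. \<Sum>i\<in>UNIV. d i x * v $ i)) (at x)"
    and e: "\<And>i. poly_alg vcoords (e i)"
      "\<And>x. (g has_derivative (\<lambda>v. \<Sum>i\<in>UNIV. e i x * v $ i)) (at x)" by blast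
  have "((\<lambda>x. f x * g x) has_derivative (\<lambda>v. \<Sum>i\<in>UNIV. (f x * e i x + d i x * g x) * v $ i)) (at x)" for x
    by (rule has_derivative_eq_rhs[OF has_derivative_mult[OF d(2) e(2)]])
      (simp add: fun_eq_iff sum.distrib ring_distribs sum_distrib_left sum_distrib_right mult_ac)
  moreover have "poly_alg vcoords (\<lambda>x. f x * e i x + d i x * g x)" for i
    by (intro poly_alg_intros d(1) e(1) mult(1,2))
  ultimately show ?case by (intro exI[of _ "\<lambda>i x. f x * e i x + d i x * g x"]) blast
qed

lemma continuous_on_poly_alg:
  fixes f :: "complex^'a \<Rightarrow> complex"
  assumes "poly_alg vcoords f" shows "continuous_on S f"
proof -
  have "isCont f x" for x
    using has_derivative_poly_alg[OF assms] has_derivative_continuous by blast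
  then show ?thesis by (simp add: continuous_at_imp_continuous_on)
qed

text \<open>
  On the complex line from a point of \<open>W\<close> to \<open>y\<close>, the function is a polynomial in one variable with
  infinitely many zeros.
\<close>

lemma poly_alg_zero_on_open:
  fixes f :: "complex^'a \<Rightarrow> complex"
  assumes f: "poly_alg vcoords f" and W: "open W" "x \<in> W" "\<And>y. y \<in> W \<Longrightarrow> f y = 0"
  shows "f y = 0"
proof -
  obtain q where q: "\<And>t. f (x + t *s (y - x)) = poly q t"
    using poly_alg_on_line[OF f] by blast
  have line: "(\<lambda>t. x + t *s (y - x)) = (\<lambda>t. \<chi> i. x $ i + t * (y $ i - x $ i))"
    by (simp add: vec_eq_iff fun_eq_iff algebra_simps)
  have cont: "continuous_on UNIV (\<lambda>t. x + t *s (y - x))"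
    unfolding line by (intro continuous_intros)
  have "open ((\<lambda>t. x + t *s (y - x)) -` W)" by (rule open_vimage[OF W(1) cont])
  moreover have "0 \<in> (\<lambda>t. x + t *s (y - x)) -` W" using W(2) by simp
  ultimately have "infinite ((\<lambda>t. x + t *s (y - x)) -` W)"
    using finite_imp_not_open by blast
  moreover have "(\<lambda>t. x + t *s (y - x)) -` W \<subseteq> {t. poly q t = 0}" using W(3) q by force
  ultimately have "q = 0" using poly_roots_finite finite_subset by blast
  then show ?thesis using q[of 1] by simp
qed

text \<open>
  This replaces the fact that polynomials form an integral domain, and it also locates the common
  nonzero: the sets \<open>f i \<noteq> 0\<close> are open and dense.
\<close>

lemma poly_alg_common_nonzero:
  fixes f :: "'i \<Rightarrow> complex^'a \<Rightarrow> complex"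
  assumes "finite S" and "\<And>i. i \<in> S \<Longrightarrow> poly_alg vcoords (f i)"
    and "\<And>i. i \<in> S \<Longrightarrow> \<exists>x. f i x \<noteq> 0" and "open W" "W \<noteq> {}"
  shows "\<exists>x\<in>W. \<forall>i\<in>S. f i x \<noteq> 0"
  using assms
proof (induction S arbitrary: W)
  case (insert k S)
  let ?W = "W \<inter> f k -` (- {0})"
  have "open ?W" using insert.prems(1,3) continuous_on_poly_alg[of "f k" UNIV]
    by (intro open_Int open_vimage insert.prems(3)) auto
  moreover have "?W \<noteq> {}"
  proof
    assume empty: "?W = {}"
    obtain x where "x \<in> W" using insert.prems(4) by blast
    then have "f k y = 0" for y
      using empty poly_alg_zero_on_open[OF insert.prems(1)[OF insertI1] insert.prems(3), of x y] by auto
    then show False using insert.prems(2)[OF insertI1] by simp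
  qed
  ultimately have "\<exists>x\<in>?W. \<forall>i\<in>S. f i x \<noteq> 0"
  proof (intro insert.IH)
    show "poly_alg vcoords (f i)" if "i \<in> S" for i using insert.prems(1)[of i] that by blast
    show "\<exists>x. f i x \<noteq> 0" if "i \<in> S" for i using insert.prems(2)[of i] that by blast
  qed
  then obtain x where "x \<in> ?W" "\<forall>i\<in>S. f i x \<noteq> 0" by blast
  then show ?case by auto
qed auto

lemma polynomial_map_jacobian:
  fixes F :: "complex^'a \<Rightarrow> complex^'b"
  assumes F: "\<And>i. poly_alg vcoords (\<lambda>x. F x $ i)"
  shows "\<exists>K. (\<forall>i j. poly_alg vcoords (\<lambda>x. K x $ i $ j)) \<and>
    (\<forall>x. (F has_derivative (\<lambda>v. K x *v v)) (at x))"
proof -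
  obtain d where d: "\<And>i j. poly_alg vcoords (d i j)"
    "\<And>i x. ((\<lambda>x. F x $ i) has_derivative (\<lambda>v. \<Sum>j\<in>UNIV. d i j x * v $ j)) (at x)"
  proof -
    have "\<forall>i. \<exists>d. (\<forall>j. poly_alg vcoords (d j)) \<and>
        (\<forall>x. ((\<lambda>x. F x $ i) has_derivative (\<lambda>v. \<Sum>j\<in>UNIV. d j x * v $ j)) (at x))"
      using has_derivative_poly_alg[OF F] by blast
    from choice[OF this] show ?thesis using that by blast
  qed
  define K where "K x = (\<chi> i j. d i j x)" for x
  have "(F has_derivative (\<lambda>v. K x *v v)) (at x)" for x
  proof -
    have F_sum: "F = (\<lambda>x. \<Sum>i\<in>UNIV. axis i (F x $ i))"
      by (auto simp: fun_eq_iff vec_eq_iff axis_def if_distrib cong: if_cong)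
    have K_sum: "(\<lambda>v. K x *v v) = (\<lambda>v. \<Sum>i\<in>UNIV. axis i (\<Sum>j\<in>UNIV. d i j x * v $ j))"
      by (auto simp: fun_eq_iff vec_eq_iff axis_def if_distrib K_def matrix_vector_mult_def cong: if_cong)
    have axis: "bounded_linear (\<lambda>c. axis i c :: complex^'b)" for i
      unfolding linear_conv_bounded_linear[symmetric]
      by (rule linearI) (auto simp: axis_def vec_eq_iff)
    show ?thesis
      unfolding K_sum by (subst F_sum)
        (intro has_derivative_sum bounded_linear.has_derivative[OF axis] d(2))
  qed
  then show ?thesis using d(1) by (intro exI[of _ K]) (simp add: K_def)
qed

lemma poly_alg_det:
  fixes K :: "'p \<Rightarrow> complex^'b^'b"
  assumes "\<And>i j. poly_alg H (\<lambda>x. K x $ i $ j)"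
  shows "poly_alg H (\<lambda>x. det (K x))"
  unfolding det_def by (intro poly_alg_intros assms)

section \<open>A surjective derivative forces dense range\<close>

lemma exists_last_index:
  assumes "\<exists>j\<le>d::nat. Q j"
  shows "\<exists>e\<le>d. Q e \<and> (\<forall>j. e < j \<longrightarrow> j \<le> d \<longrightarrow> \<not> Q j)"
proof -
  have "finite {j. j \<le> d \<and> Q j}" "{j. j \<le> d \<and> Q j} \<noteq> {}" using assms by auto
  then show ?thesis
    using Max_in[of "{j. j \<le> d \<and> Q j}"] Max_ge[of "{j. j \<le> d \<and> Q j}"]
    by (intro exI[of _ "Max {j. j \<le> d \<and> Q j}"]) (auto simp: not_le[symmetric])
qed

text \<open>
  The components of \<open>\<phi>\<close> together with \<open>h\<close> are more functions than there are variables. Not all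
  coefficients \<open>C j\<close> are zero as polynomials, although nothing is said here about their composites
  with \<open>\<phi>\<close>. In the relation, index \<open>None\<close> stands for \<open>h\<close> and \<open>Some i\<close> for the component \<open>\<phi> i\<close>.
\<close>

lemma algebraic_over_polynomial_map:
  fixes \<phi> :: "complex^'a \<Rightarrow> complex^'b"
  assumes dim: "CARD('a) \<le> CARD('b)"
    and \<phi>: "\<And>i. poly_alg vcoords (\<lambda>x. \<phi> x $ i)" and h: "poly_alg vcoords h"
  shows "\<exists>d C. (\<forall>j. poly_alg vcoords (C j)) \<and> (\<exists>j\<le>d. \<exists>z. C j z \<noteq> 0) \<and>
    (\<forall>x. (\<Sum>j\<le>d::nat. C j (\<phi> x) * h x ^ j) = 0)"
proof -
  define g where "g o' = (case o' of None \<Rightarrow> h | Some i \<Rightarrow> (\<lambda>x. \<phi> x $ i))" for o'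
  have g: "poly_alg vcoords (g o')" for o'
    using \<phi> h by (cases o') (auto simp: g_def)
  have "card (vcoords :: (complex^'a \<Rightarrow> complex) set) < card (UNIV :: 'b option set)"
    using card_vcoords[where 'a = 'a] dim by (simp add: card_UNIV_option)
  then obtain P where P: "poly_alg (coords (UNIV :: 'b option set)) P" "\<exists>z. P z \<noteq> 0"
    "\<And>x. P (\<lambda>i. g i x) = 0"
    using exists_polynomial_relation[of "UNIV :: 'b option set" vcoords g] g by auto
  have "poly_alg (coords (insert None (range Some))) P"
    using P(1) by (simp add: UNIV_option_conv[symmetric])
  then obtain d C where C: "\<And>j. poly_alg (coords (range Some)) (C j)"
    "\<And>z. P z = (\<Sum>j\<le>d::nat. C j z * z None ^ j)"
    using poly_alg_split_variable[of None "range Some" P] by blast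
  define E where "E j z = C j (case_option 0 (($) z))" for j and z :: "complex^'b"
  have E: "poly_alg vcoords (E j)" for j
    unfolding E_def
    by (rule poly_alg_compose[where g = "\<lambda>o' z. case_option 0 (($) z) o'", OF C(1)])
      (auto intro: poly_alg_vcoord)
  have "\<exists>j\<le>d. \<exists>z. E j z \<noteq> 0"
  proof -
    obtain z where z: "P z \<noteq> 0" using P(2) by blast
    then have "(\<Sum>j\<le>d. C j z * z None ^ j) \<noteq> 0" using C(2) by simp
    then obtain j where "j \<in> {..d}" "C j z * z None ^ j \<noteq> 0"
      by (rule sum.not_neutral_contains_not_neutral)
    then have j: "j \<le> d" "C j z \<noteq> 0" by auto
    have "C j z = E j (\<chi> i. z (Some i))"
      unfolding E_def by (rule poly_alg_coords_cong[OF C(1)]) auto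
    then show ?thesis using j by auto
  qed
  moreover have "(\<Sum>j\<le>d. E j (\<phi> x) * h x ^ j) = 0" for x
  proof -
    have "C j (\<lambda>i. g i x) = E j (\<phi> x)" for j
      unfolding E_def by (rule poly_alg_coords_cong[OF C(1)]) (auto simp: g_def)
    then show ?thesis using P(3)[of x] C(2) by (simp add: g_def)
  qed
  ultimately show ?thesis using E by blast
qed

text \<open>
  The leading coefficient controls the roots: where it stays away from zero, algebraic functions
  cannot escape to infinity.
\<close>

lemma root_bound:
  fixes a :: "nat \<Rightarrow> complex"
  assumes "(\<Sum>j\<le>d. a j * h ^ j) = 0" "a d \<noteq> 0"
  shows "norm h \<le> 1 + (\<Sum>j<d. norm (a j)) / norm (a d)"
proof (cases "norm h \<le> 1")
  case True
  moreover have "0 \<le> (\<Sum>j<d. norm (a j)) / norm (a d)" by (intro divide_nonneg_nonneg sum_nonneg) auto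
  ultimately show ?thesis by linarith
next
  case False
  have "d \<noteq> 0" using assms by (intro notI) simp
  then obtain e where e: "d = Suc e" by (cases d) auto
  have eq: "a d * h ^ d = - (\<Sum>j<d. a j * h ^ j)"
    using assms(1) by (simp add: lessThan_Suc_atMost[symmetric] add_eq_0_iff)
  have "norm (a d) * norm h ^ d = norm (a d * h ^ d)" by (simp add: norm_mult norm_power)
  also have "\<dots> = norm (\<Sum>j<d. a j * h ^ j)" by (simp add: eq)
  also have "\<dots> \<le> (\<Sum>j<d. norm (a j) * norm h ^ e)"
  proof (rule sum_norm_le)
    fix j assume "j \<in> {..<d}"
    then have "norm h ^ j \<le> norm h ^ e" using False e by (intro power_increasing) auto
    then show "norm (a j * h ^ j) \<le> norm (a j) * norm h ^ e"
      by (simp add: norm_mult norm_power mult_left_mono)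
  qed
  also have "\<dots> = (\<Sum>j<d. norm (a j)) * norm h ^ e" by (simp add: sum_distrib_right)
  finally have "(norm (a d) * norm h) * norm h ^ e \<le> (\<Sum>j<d. norm (a j)) * norm h ^ e"
    by (simp add: e mult_ac)
  then have "norm (a d) * norm h \<le> (\<Sum>j<d. norm (a j))"
  proof (rule mult_right_le_imp_le)
    show "0 < norm h ^ e" using False by (intro zero_less_power) linarith
  qed
  then have "norm h \<le> (\<Sum>j<d. norm (a j)) / norm (a d)"
    using assms(2) by (simp add: pos_le_divide_eq mult.commute)
  then show ?thesis by simp
qed

lemma roots_bounded:
  fixes a :: "nat \<Rightarrow> nat \<Rightarrow> complex" and h :: "nat \<Rightarrow> complex"
  assumes rel: "\<And>n. (\<Sum>j\<le>d. a j n * h n ^ j) = 0"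
    and lim: "\<And>j. a j \<longlonglongrightarrow> l j" and l: "l d \<noteq> 0"
  shows "Bseq h"
proof -
  have "(\<lambda>n. 1 + (\<Sum>j<d. norm (a j n)) / norm (a d n)) \<longlonglongrightarrow> 1 + (\<Sum>j<d. norm (l j)) / norm (l d)"
    using l by (intro tendsto_intros lim) auto
  then have "Bseq (\<lambda>n. 1 + (\<Sum>j<d. norm (a j n)) / norm (a d n))"
    by (intro convergent_imp_Bseq convergentI)
  moreover have "\<forall>\<^sub>F n in sequentially. norm (h n) \<le> norm (1 + (\<Sum>j<d. norm (a j n)) / norm (a d n))"
    using tendsto_imp_eventually_ne[OF lim l]
  proof eventually_elim
    case (elim n)
    show ?case using root_bound[OF rel[of n] elim] by simp
  qed
  ultimately show ?thesis by (rule Bseq_eventually_mono[rotated])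
qed

lemma relation_with_leading_coefficient:
  fixes \<phi> :: "complex^'a \<Rightarrow> complex^'b"
  assumes dim: "CARD('a) \<le> CARD('b)"
    and \<phi>: "\<And>i. poly_alg vcoords (\<lambda>x. \<phi> x $ i)" and h: "poly_alg vcoords h"
  shows "\<exists>d C. (\<forall>j. poly_alg vcoords (C j)) \<and> (\<exists>z. C d z \<noteq> 0) \<and>
    (\<forall>x. (\<Sum>j\<le>d::nat. C j (\<phi> x) * h x ^ j) = 0)"
proof -
  obtain d C where C: "\<And>j. poly_alg vcoords (C j)" "\<exists>j\<le>d. \<exists>z. C j z \<noteq> 0"
    "\<And>x. (\<Sum>j\<le>d::nat. C j (\<phi> x) * h x ^ j) = 0"
    using algebraic_over_polynomial_map[OF assms] by blast
  obtain e where e: "e \<le> d" "\<exists>z. C e z \<noteq> 0" "\<And>j z. e < j \<Longrightarrow> j \<le> d \<Longrightarrow> C j z = 0"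
    using exists_last_index[OF C(2)] by blast
  have "(\<Sum>j\<le>e. C j (\<phi> x) * h x ^ j) = (\<Sum>j\<le>d. C j (\<phi> x) * h x ^ j)" for x
    using e(1,3) by (intro sum.mono_neutral_left) auto
  then have "\<forall>x. (\<Sum>j\<le>e. C j (\<phi> x) * h x ^ j) = 0" using C(3) by presburger
  then show ?thesis using C(1) e(2) by blast
qed

text \<open>
  Cancelling a power of \<open>h\<close> makes the constant coefficient nonzero. Wherever that coefficient is
  nonzero, \<open>h\<close> cannot tend to zero. The cancellation is only valid where \<open>h x \<noteq> 0\<close>.
\<close>

lemma relation_with_constant_coefficient:
  fixes \<phi> :: "complex^'a \<Rightarrow> complex^'b"
  assumes dim: "CARD('a) \<le> CARD('b)"
    and \<phi>: "\<And>i. poly_alg vcoords (\<lambda>x. \<phi> x $ i)" and h: "poly_alg vcoords h"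
  shows "\<exists>d C. (\<forall>j. poly_alg vcoords (C j)) \<and> (\<exists>z. C 0 z \<noteq> 0) \<and>
    (\<forall>x. h x \<noteq> 0 \<longrightarrow> (\<Sum>j\<le>d::nat. C j (\<phi> x) * h x ^ j) = 0)"
proof -
  obtain d C where C: "\<And>j. poly_alg vcoords (C j)" "\<exists>j\<le>d. \<exists>z. C j z \<noteq> 0"
    "\<And>x. (\<Sum>j\<le>d::nat. C j (\<phi> x) * h x ^ j) = 0"
    using algebraic_over_polynomial_map[OF assms] by blast
  define s where "s = (LEAST j. j \<le> d \<and> (\<exists>z. C j z \<noteq> 0))"
  have s: "s \<le> d \<and> (\<exists>z. C s z \<noteq> 0)"
    unfolding s_def
    by (rule LeastI_ex[of "\<lambda>j. j \<le> d \<and> (\<exists>z. C j z \<noteq> 0)"]) (use C(2) in blast)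
  have low: "C j z = 0" if "j < s" for j z
    using not_less_Least[of j "\<lambda>j. j \<le> d \<and> (\<exists>z. C j z \<noteq> 0)"] that s by (auto simp: s_def)
  have "(\<Sum>j\<le>d - s. C (j + s) (\<phi> x) * h x ^ j) = 0" if "h x \<noteq> 0" for x
  proof -
    have "(\<Sum>j\<le>d - s. C (j + s) (\<phi> x) * h x ^ j) * h x ^ s = (\<Sum>j\<in>{s..d}. C j (\<phi> x) * h x ^ j)"
      unfolding sum_distrib_right
      using s by (intro sum.reindex_bij_witness[of _ "\<lambda>j. j - s" "\<lambda>j. j + s"])
        (auto simp: power_add)
    also have "\<dots> = (\<Sum>j\<le>d. C j (\<phi> x) * h x ^ j)"
      using low by (intro sum.mono_neutral_left) auto
    finally show ?thesis using C(3) that by simp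
  qed
  moreover have "\<exists>z. C (0 + s) z \<noteq> 0" using s by simp
  ultimately show ?thesis using C(1) by (intro exI[of _ "d - s"] exI[of _ "\<lambda>j. C (j + s)"]) blast
qed

lemma bounded_range_vec:
  fixes x :: "nat \<Rightarrow> complex^'a"
  assumes "\<And>i. Bseq (\<lambda>n. x n $ i)" shows "bounded (range x)"
proof -
  have "\<forall>i. \<exists>B. \<forall>n. norm (x n $ i) \<le> B" using assms by (auto simp: Bseq_def)
  then obtain B where B: "\<And>i n. norm (x n $ i) \<le> B i" by metis
  have "norm (x n) \<le> (\<Sum>i\<in>UNIV. B i)" for n
  proof -
    have "norm (x n) \<le> (\<Sum>i\<in>UNIV. norm (x n $ i))"
      unfolding norm_vec_def by (rule L2_set_le_sum) simp
    also have "\<dots> \<le> (\<Sum>i\<in>UNIV. B i)" by (rule sum_mono) (rule B)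
    finally show ?thesis .
  qed
  then show ?thesis by (auto simp: bounded_iff)
qed

text \<open>
  Let \<open>U\<close> be the set where the Jacobian determinant \<open>J\<close> is nonzero. There \<open>\<phi>\<close> is open. The
  coordinates and \<open>J\<close> are algebraic over the components of \<open>\<phi>\<close>; let \<open>G\<close> be the product of the leading
  coefficients of the relations for the coordinates and the constant coefficient of the relation for
  \<open>J\<close>. Over a point \<open>z\<close> with \<open>G z \<noteq> 0\<close> the restriction of \<open>\<phi>\<close> to \<open>U\<close> is proper: if \<open>\<phi> (x n)\<close> tends
  to \<open>z\<close>, then the points \<open>x n\<close> stay bounded, and a limit point has \<open>J \<noteq> 0\<close>. Thus the part of
  \<open>\<phi> ` U\<close> in \<open>{z. G z \<noteq> 0}\<close> is both open and closed there. A complex line through a point of \<open>{z. G z \<noteq> 0}\<close> meets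
  this set in the complement of a finite set, and this complement is connected and dense in the line. It is here that the field being \<open>\<complex>\<close>
  matters: over the reals a finite set disconnects a line, and \<open>x\<^sup>2\<close> does not have dense range.
\<close>

lemma dense_range_square:
  fixes \<phi> :: "complex^'b \<Rightarrow> complex^'b"
  assumes \<phi>: "\<And>i. poly_alg vcoords (\<lambda>x. \<phi> x $ i)"
    and id: "(\<phi> has_derivative (\<lambda>v. v)) (at 0)"
  shows "closure (range \<phi>) = UNIV"
proof -
  obtain K where K: "\<And>i j. poly_alg vcoords (\<lambda>x. K x $ i $ j)"
    "\<And>x. (\<phi> has_derivative (\<lambda>v. K x *v v)) (at x)"
    using polynomial_map_jacobian[OF \<phi>] by blast
  have cont: "continuous_on S \<phi>" for S
    using K(2) by (meson continuous_at_imp_continuous_on has_derivative_continuous)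
  define J where "J x = det (K x)" for x
  have J: "poly_alg vcoords J" unfolding J_def by (rule poly_alg_det) (rule K(1))
  define U where "U = {x. J x \<noteq> 0}"
  have U_eq: "U = J -` (- {0})" by (auto simp: U_def)
  have open_U: "open U" unfolding U_eq
    using continuous_on_poly_alg[OF J, of UNIV] by (intro open_vimage) auto
  have "(*v) (K 0) = (\<lambda>v. v)" using has_derivative_unique[OF K(2) id] by simp
  then have "K 0 = mat 1" by (simp add: matrix_eq fun_eq_iff)
  then have U0: "0 \<in> U" by (simp add: U_def J_def)
  have open_image: "open (\<phi> ` U)"
  proof -
    have "\<phi> x \<in> interior (\<phi> ` U)" if x: "x \<in> U" for x
    proof -
      have "invertible (K x)" using x by (simp add: U_def J_def invertible_det_nz)
      then obtain B where B: "K x ** B = mat 1" by (auto simp: invertible_def)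
      show ?thesis
      proof (rule sussmann_open_mapping[OF open_UNIV cont UNIV_I K(2)])
        show "(*v) (K x) \<circ> (*v) B = id" by (simp add: fun_eq_iff matrix_vector_mul_assoc B)
        show "bounded_linear ((*v) B)" by simp
        show "x \<in> interior U" using open_U x by (simp add: interior_open)
      qed simp
    qed
    then have "\<phi> ` U \<subseteq> interior (\<phi> ` U)" by blast
    then show ?thesis using interior_subset subset_antisym open_interior by metis
  qed
  have "\<forall>i. \<exists>d C. (\<forall>j. poly_alg vcoords (C j)) \<and> (\<exists>z. C d z \<noteq> 0) \<and>
      (\<forall>x. (\<Sum>j\<le>d::nat. C j (\<phi> x) * x $ i ^ j) = 0)"
    using relation_with_leading_coefficient[OF order.refl \<phi>] poly_alg_vcoord by blast
  from choice[OF this] obtain d where "\<forall>i. \<exists>C. (\<forall>j. poly_alg vcoords (C j)) \<and>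
      (\<exists>z. C (d i) z \<noteq> 0) \<and> (\<forall>x. (\<Sum>j\<le>d i. C j (\<phi> x) * x $ i ^ j) = 0)"
    by blast
  from choice[OF this] obtain C where C: "\<And>i j. poly_alg vcoords (C i j)"
    "\<And>i. \<exists>z. C i (d i) z \<noteq> 0" "\<And>i x. (\<Sum>j\<le>d i. C i j (\<phi> x) * x $ i ^ j) = 0"
    by blast
  obtain m E where E: "\<And>j. poly_alg vcoords (E j)" "\<exists>z. E 0 z \<noteq> 0"
    "\<And>x. x \<in> U \<Longrightarrow> (\<Sum>j\<le>m::nat. E j (\<phi> x) * J x ^ j) = 0"
    using relation_with_constant_coefficient[OF order.refl \<phi> J] unfolding U_def by blast
  define G where "G z = E 0 z * (\<Prod>i\<in>UNIV. C i (d i) z)" for z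
  have G: "poly_alg vcoords G" unfolding G_def by (intro poly_alg_intros E C)
  have closed: "z \<in> \<phi> ` U"
    if x: "\<And>n. x n \<in> U" and lim: "(\<lambda>n. \<phi> (x n)) \<longlonglongrightarrow> z" and z: "G z \<noteq> 0" for x z
  proof -
    have lim_poly: "(\<lambda>n. f (\<phi> (x n))) \<longlonglongrightarrow> f z" if "poly_alg vcoords f" for f
      using continuous_on_tendsto_compose[OF continuous_on_poly_alg[OF that, of UNIV] lim] by simp
    have "Bseq (\<lambda>n. x n $ i)" for i
    proof (rule roots_bounded)
      show "(\<Sum>j\<le>d i. C i j (\<phi> (x n)) * x n $ i ^ j) = 0" for n by (rule C(3))
      show "(\<lambda>n. C i j (\<phi> (x n))) \<longlonglongrightarrow> C i j z" for j by (rule lim_poly[OF C(1)])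
      show "C i (d i) z \<noteq> 0" using z by (auto simp: G_def)
    qed
    then have "bounded (range x)" by (rule bounded_range_vec)
    then obtain l r where r: "strict_mono r" "(x \<circ> r) \<longlonglongrightarrow> l"
      using bounded_imp_convergent_subsequence by blast
    have "(\<lambda>n. \<phi> ((x \<circ> r) n)) \<longlonglongrightarrow> \<phi> l"
      using continuous_on_tendsto_compose[OF cont[of UNIV] r(2)] by simp
    moreover have "(\<lambda>n. \<phi> ((x \<circ> r) n)) \<longlonglongrightarrow> z"
      using LIMSEQ_subseq_LIMSEQ[OF lim r(1)] by (simp add: o_def)
    ultimately have l: "\<phi> l = z" by (rule LIMSEQ_unique)
    have J_lim: "(\<lambda>n. J ((x \<circ> r) n)) \<longlonglongrightarrow> J l"
      using continuous_on_tendsto_compose[OF continuous_on_poly_alg[OF J, of UNIV] r(2)] by simp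
    \<comment> \<open>If \<open>J l\<close> were zero, only the constant coefficient would survive in the limit of the relation.\<close>
    have "(\<lambda>n. \<Sum>j\<le>m. E j (\<phi> ((x \<circ> r) n)) * J ((x \<circ> r) n) ^ j) \<longlonglongrightarrow> (\<Sum>j\<le>m. E j z * J l ^ j)"
    proof (intro tendsto_intros J_lim)
      show "(\<lambda>n. E j (\<phi> ((x \<circ> r) n))) \<longlonglongrightarrow> E j z" for j
        using LIMSEQ_subseq_LIMSEQ[OF lim_poly[OF E(1)] r(1)] by (simp add: o_def)
    qed
    then have "(\<Sum>j\<le>m. E j z * J l ^ j) = 0"
      using E(3)[OF x] by (simp add: LIMSEQ_const_iff)
    moreover have "E 0 z \<noteq> 0" using z by (auto simp: G_def)
    ultimately have "J l \<noteq> 0"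
      by (intro notI) (simp add: power_0_left if_distrib cong: if_cong)
    then show ?thesis using l by (auto simp: U_def)
  qed
  \<comment> \<open>The image of \<open>U\<close> is open and nonempty, so it contains a point where \<open>G\<close> does not vanish.\<close>
  have "\<exists>z\<in>\<phi> ` U. \<forall>i\<in>UNIV. (case_option (E 0) (\<lambda>i. C i (d i)) i) z \<noteq> 0"
  proof (rule poly_alg_common_nonzero[OF _ _ _ open_image])
    show "poly_alg vcoords (case_option (E 0) (\<lambda>i. C i (d i)) i)" for i
      using E(1) C(1) by (cases i) auto
    show "\<exists>z. (case_option (E 0) (\<lambda>i. C i (d i)) i) z \<noteq> 0" for i
      using E(2) C(2) by (cases i) auto
  qed (use U0 in auto)
  then obtain z0 where z0: "z0 \<in> \<phi> ` U" "\<And>i. (case_option (E 0) (\<lambda>i. C i (d i)) i) z0 \<noteq> 0"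
    by blast
  have Gz0: "G z0 \<noteq> 0" using z0(2)[of None] z0(2)[of "Some _"] by (simp add: G_def)
  have "z \<in> closure (range \<phi>)" for z
  proof -
    define l where "l t = z0 + t *s (z - z0)" for t
    obtain q where q: "\<And>t. G (l t) = poly q t"
      using poly_alg_on_line[OF G] unfolding l_def by blast
    have "l = (\<lambda>t. \<chi> i. z0 $ i + t * (z $ i - z0 $ i))"
      by (simp add: l_def vec_eq_iff fun_eq_iff algebra_simps)
    then have cont_l: "continuous_on S l" for S
      by (simp only:) (intro continuous_intros)
    have q0: "q \<noteq> 0" using q[of 0] Gz0 by (auto simp: l_def)
    have fin: "finite {t. poly q t = 0}" by (rule poly_roots_finite[OF q0])
    define T where "T = - {t. poly q t = 0}"
    have "connected T"
      unfolding T_def using fin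
      by (intro path_connected_imp_connected path_connected_complement_countable countable_finite) auto
    moreover have "openin (top_of_set T) (T \<inter> l -` (\<phi> ` U))"
      using continuous_openin_preimage_gen[OF cont_l open_image, of T] .
    moreover have "closedin (top_of_set T) (T \<inter> l -` (\<phi> ` U))"
      unfolding closedin_limpt
    proof (intro conjI allI impI)
      fix a assume a: "a islimpt T \<inter> l -` (\<phi> ` U) \<and> a \<in> T"
      then obtain t where ta: "\<forall>n. t n \<in> T \<inter> l -` (\<phi> ` U)" "a \<in> T" "t \<longlonglongrightarrow> a"
        unfolding islimpt_sequential by blast
      then have "\<forall>n. \<exists>y. y \<in> U \<and> l (t n) = \<phi> y" by blast
      from choice[OF this] obtain x where x: "\<And>n. x n \<in> U" "\<And>n. l (t n) = \<phi> (x n)" by blast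
      have "(\<lambda>n. l (t n)) \<longlonglongrightarrow> l a"
        using continuous_on_tendsto_compose[OF cont_l[of UNIV], of t a] ta by simp
      then have "(\<lambda>n. \<phi> (x n)) \<longlonglongrightarrow> l a" by (simp add: x(2))
      moreover have "G (l a) \<noteq> 0" using ta q by (simp add: T_def)
      ultimately have "l a \<in> \<phi> ` U" using closed x(1) by blast
      then show "a \<in> T \<inter> l -` (\<phi> ` U)" using ta by blast
    qed simp
    moreover have "0 \<in> T \<inter> l -` (\<phi> ` U)"
      using Gz0 q[of 0] z0(1) by (simp add: T_def l_def)
    ultimately have "T \<inter> l -` (\<phi> ` U) = T"
      using connected_clopen by blast
    then have "l ` T \<subseteq> range \<phi>" by auto
    moreover have "closure T = UNIV"
      unfolding T_def using fin by (simp add: closure_complement empty_interior_finite)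
    then have "l ` UNIV \<subseteq> closure (l ` T)"
      using image_closure_subset[OF cont_l[of "closure T"] closed_closure closure_subset] by simp
    moreover have "l 1 = z" by (simp add: l_def)
    ultimately show ?thesis by (metis closure_mono range_subsetD subsetD)
  qed
  then show ?thesis by blast
qed

text \<open>
  A complex linear right inverse \<open>B\<close> of the derivative at \<open>p\<close> parametrizes an affine slice through \<open>p\<close>
  on which the map becomes square and has identity derivative at \<open>p\<close>.
\<close>

lemma dense_range_of_surjective_derivative:
  fixes F :: "complex^'a \<Rightarrow> complex^'b"
  assumes F: "\<And>i. poly_alg vcoords (\<lambda>x. F x $ i)"
    and F': "(F has_derivative F') (at p)" and surj: "surj F'"
  shows "closure (range F) = UNIV"
proof -
  obtain K where K: "(F has_derivative (\<lambda>v. K *v v)) (at p)"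
    using polynomial_map_jacobian[OF F] by blast
  then have "F' = (*v) K" using has_derivative_unique[OF F'] by simp
  then obtain B where B: "K ** B = mat 1"
    using surj matrix_right_invertible_surjective[of K] by auto
  define \<phi> where "\<phi> w = F (p + B *v w)" for w
  have "closure (range \<phi>) = UNIV"
  proof (rule dense_range_square)
    show "poly_alg vcoords (\<lambda>w. \<phi> w $ i)" for i
      unfolding \<phi>_def
    proof (rule poly_alg_vcompose[OF F])
      show "poly_alg vcoords (\<lambda>w. (p + B *v w) $ j)" for j
        by (simp add: matrix_vector_mult_def) (intro poly_alg_intros poly_alg_vcoord)
    qed
    have "(F has_derivative (\<lambda>v. K *v v)) (at (p + B *v 0))" using K by simp
    moreover have "((\<lambda>w. p + B *v w) has_derivative (\<lambda>v. B *v v)) (at 0)"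
      by (auto intro!: derivative_eq_intros bounded_linear_imp_has_derivative)
    ultimately have "(\<phi> has_derivative (\<lambda>v. K *v (B *v v))) (at 0)"
      unfolding \<phi>_def by (rule has_derivative_compose[rotated])
    then show "(\<phi> has_derivative (\<lambda>v. v)) (at 0)" by (simp add: matrix_vector_mul_assoc B)
  qed
  moreover have "range \<phi> \<subseteq> range F" by (auto simp: \<phi>_def)
  ultimately show ?thesis using closure_mono by blast
qed

section \<open>Dense range forces a surjective derivative\<close>

definition algebraically_independent :: "'i set \<Rightarrow> ('i \<Rightarrow> 'p \<Rightarrow> complex) \<Rightarrow> bool"
  where "algebraically_independent I g \<longleftrightarrow>
    (\<forall>P. poly_alg (coords I) P \<longrightarrow> (\<forall>p. P (\<lambda>i. g i p) = 0) \<longrightarrow> (\<forall>z. P z = 0))"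

text \<open>
  Independence of the old functions ensures that the leading coefficient stays nonzero after the
  functions are substituted into it.
\<close>

lemma algebraic_of_dependent_insert:
  assumes indep: "algebraically_independent I g" and dep: "\<not> algebraically_independent (insert t I) g"
  shows "\<exists>d c. (\<forall>j. poly_alg (g ` I) (c j)) \<and> (\<exists>p. c d p \<noteq> 0) \<and>
    (\<forall>p. (\<Sum>j\<le>d::nat. c j p * g t p ^ j) = 0)"
proof -
  obtain P z where P: "poly_alg (coords (insert t I)) P" "\<And>p. P (\<lambda>i. g i p) = 0" "P z \<noteq> 0"
    using dep unfolding algebraically_independent_def by blast
  obtain d C where C: "\<And>j. poly_alg (coords I) (C j)" "\<And>z. P z = (\<Sum>j\<le>d::nat. C j z * z t ^ j)"
    using poly_alg_split_variable[OF P(1)] by blast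
  define c where "c j p = C j (\<lambda>i. g i p)" for j p
  have c: "poly_alg (g ` I) (c j)" for j
    unfolding c_def by (rule poly_alg_compose[OF C(1)]) (auto intro: poly_alg_gen)
  have rel: "(\<Sum>j\<le>d. c j p * g t p ^ j) = 0" for p
    using P(2)[of p] C(2) by (simp add: c_def)
  have "(\<Sum>j\<le>d. C j z * z t ^ j) \<noteq> 0" using P(3) C(2) by simp
  then obtain j where "j \<in> {..d}" "C j z * z t ^ j \<noteq> 0"
    by (rule sum.not_neutral_contains_not_neutral)
  then have "\<exists>p. c j p \<noteq> 0" "j \<le> d"
    using indep C(1)[of j] unfolding algebraically_independent_def c_def by auto
  then obtain e where e: "e \<le> d" "\<exists>p. c e p \<noteq> 0" "\<And>j p. e < j \<Longrightarrow> j \<le> d \<Longrightarrow> c j p = 0"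
    using exists_last_index[of d "\<lambda>j. \<exists>p. c j p \<noteq> 0"] by blast
  have "(\<Sum>j\<le>e. c j p * g t p ^ j) = (\<Sum>j\<le>d. c j p * g t p ^ j)" for p
    using e(1,3) by (intro sum.mono_neutral_left) auto
  then have "\<forall>p. (\<Sum>j\<le>e. c j p * g t p ^ j) = 0" using rel by presburger
  then show ?thesis using c e(2) by blast
qed

text \<open>
  In characteristic zero every algebraic element is separable: for a relation of least degree \<open>d\<close>, the
  formal derivative is a polynomial of degree \<open>d - 1\<close> with nonzero leading coefficient, so it cannot
  vanish identically at \<open>h\<close>.
\<close>

lemma separable_relation:
  assumes "\<exists>d c. (\<forall>j. poly_alg K (c j)) \<and> (\<exists>p. c d p \<noteq> 0) \<and> (\<forall>p. (\<Sum>j\<le>d::nat. c j p * h p ^ j) = 0)"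
  shows "\<exists>d c. (\<forall>j. poly_alg K (c j)) \<and> (\<forall>p. (\<Sum>j\<le>d::nat. c j p * h p ^ j) = 0) \<and>
    (\<exists>p. (\<Sum>j\<le>d. c j p * (of_nat j * h p ^ (j - 1))) \<noteq> 0)"
proof -
  define R where "R d \<longleftrightarrow> (\<exists>c. (\<forall>j. poly_alg K (c j)) \<and> (\<exists>p. c d p \<noteq> 0) \<and>
    (\<forall>p. (\<Sum>j\<le>d::nat. c j p * h p ^ j) = 0))" for d
  have "\<exists>d. R d" using assms by (simp add: R_def)
  then obtain d where d: "R d" "\<And>e. e < d \<Longrightarrow> \<not> R e"
    using exists_least_iff[of R] by blast
  obtain c where c: "\<And>j. poly_alg K (c j)" "\<exists>p. c d p \<noteq> 0" "\<And>p. (\<Sum>j\<le>d. c j p * h p ^ j) = 0"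
    using d(1) unfolding R_def by blast
  have "d \<noteq> 0" using c(2,3) by (intro notI) simp
  then obtain e where e: "d = Suc e" by (cases d) auto
  have "\<exists>p. (\<Sum>j\<le>d. c j p * (of_nat j * h p ^ (j - 1))) \<noteq> 0"
  proof (rule ccontr)
    assume *: "\<nexists>p. (\<Sum>j\<le>d. c j p * (of_nat j * h p ^ (j - 1))) \<noteq> 0"
    have "R e" unfolding R_def
    proof (intro exI[of _ "\<lambda>j p. of_nat (Suc j) * c (Suc j) p"] conjI allI)
      show "poly_alg K (\<lambda>p. of_nat (Suc j) * c (Suc j) p)" for j
        by (intro poly_alg_intros c(1))
      show "\<exists>p. of_nat (Suc e) * c (Suc e) p \<noteq> 0"
        using c(2) by (simp add: e del: of_nat_Suc)
      show "(\<Sum>j\<le>e. of_nat (Suc j) * c (Suc j) p * h p ^ j) = 0" for p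
      proof -
        have "(\<Sum>j\<le>d. c j p * (of_nat j * h p ^ (j - 1))) =
            (\<Sum>j\<le>e. c (Suc j) p * (of_nat (Suc j) * h p ^ j))"
          unfolding e sum.atMost_Suc_shift by simp
        then show ?thesis using * by (simp add: mult_ac)
      qed
    qed
    then show False using d(2)[of e] e by simp
  qed
  then show ?thesis using c(1,3) by blast
qed

text \<open>
  By the chain rule, a direction annihilated by the differentials of the generators is annihilated by
  the differential of every polynomial in them.
\<close>

lemma poly_alg_derivative_kernel:
  fixes v :: "complex^'a"
  assumes "poly_alg K a"
    and "\<And>g. g \<in> K \<Longrightarrow> \<exists>g'. (g has_derivative g') (at x) \<and> g' v = 0"
  shows "\<exists>a'. (a has_derivative a') (at x) \<and> a' v = 0"
  using assms(1)
proof (induction rule: poly_alg_induct)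
  case (const c)
  show ?case by (intro exI[of _ "\<lambda>_. 0"]) simp
next
  case (gen g)
  then show ?case by (rule assms(2))
next
  case (add f g)
  then obtain f' g' where "(f has_derivative f') (at x)" "f' v = 0"
    "(g has_derivative g') (at x)" "g' v = 0" by blast
  then show ?case by (intro exI[of _ "\<lambda>v. f' v + g' v"]) (auto intro: has_derivative_add)
next
  case (mult f g)
  then obtain f' g' where "(f has_derivative f') (at x)" "f' v = 0"
    "(g has_derivative g') (at x)" "g' v = 0" by blast
  then show ?case by (intro exI[of _ "\<lambda>v. f x * g' v + f' v * g x"]) (auto intro: has_derivative_mult)
qed

text \<open>
  A polynomial that vanishes on the range of \<open>F\<close> vanishes on its closure, so the components of \<open>F\<close> are
  algebraically independent. Complete them by coordinates \<open>x j\<close>, \<open>j \<in> J\<close>, to a maximal algebraically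
  independent family. The remaining coordinates are algebraic over this family, so at a generic
  point \<open>p\<close> their differentials are combinations of the differentials of the family. Hence a vector
  that is annihilated by the latter is zero. The family has at most \<open>CARD('a)\<close> members, by counting,
  so its differentials define a linear map that is injective and therefore bijective; in particular
  the differentials of the components of \<open>F\<close> are jointly surjective.
\<close>

lemma exists_surjective_derivative:
  fixes F :: "complex^'a \<Rightarrow> complex^'b"
  assumes F: "\<And>i. poly_alg vcoords (\<lambda>x. F x $ i)" and dense: "closure (range F) = UNIV"
  shows "\<exists>p F'. (F has_derivative F') (at p) \<and> surj F'"
proof -
  obtain M where M: "\<And>x. (F has_derivative (\<lambda>v. M x *v v)) (at x)"
    using polynomial_map_jacobian[OF F] by blast
  define g where "g k = (case k of Inl i \<Rightarrow> \<lambda>x. F x $ i | Inr j \<Rightarrow> \<lambda>x. x $ j)" for k :: "'b + 'a"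
  have g: "poly_alg vcoords (g k)" for k
    using F by (cases k) (auto simp: g_def poly_alg_vcoord)
  define dg where "dg p k v = (case k of Inl i \<Rightarrow> (M p *v v) $ i | Inr j \<Rightarrow> v $ j)"
    for p and k :: "'b + 'a" and v :: "complex^'a"
  have dg: "(g k has_derivative dg p k) (at p)" for k p
    using M bounded_linear.has_derivative[OF bounded_linear_vec_nth M]
      bounded_linear_imp_has_derivative[OF bounded_linear_vec_nth]
    by (cases k) (simp_all add: g_def dg_def[abs_def])
  define indep where "indep J \<longleftrightarrow> algebraically_independent (UNIV <+> J) g" for J
  have "indep {}" unfolding indep_def algebraically_independent_def
  proof (intro allI impI)
    fix P z assume P: "poly_alg (coords ((UNIV :: 'b set) <+> ({} :: 'a set))) P"
      and zero: "\<forall>p. P (\<lambda>i. g i p) = 0"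
    define E where "E w = P (case_sum (($) w) (\<lambda>_. 0))" for w :: "complex^'b"
    have E: "poly_alg vcoords E" unfolding E_def
      by (rule poly_alg_compose[where g = "\<lambda>k w. case_sum (($) w) (\<lambda>_. 0) k", OF P])
        (auto intro: poly_alg_vcoord)
    have "E (F x) = P (\<lambda>i. g i x)" for x
      unfolding E_def by (rule poly_alg_coords_cong[OF P]) (auto simp: g_def)
    then have "E w = 0" for w
      using continuous_constant_on_closure[OF continuous_on_poly_alg[OF E], of "range F" 0 w] zero dense
      by auto
    moreover have "P z = E (\<chi> i. z (Inl i))"
      unfolding E_def by (rule poly_alg_coords_cong[OF P]) auto
    ultimately show "P z = 0" by simp
  qed
  then obtain J where J: "indep J" and J_max: "\<And>J'. indep J' \<Longrightarrow> J \<subseteq> J' \<Longrightarrow> J = J'"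
    using finite_has_maximal[of "{J. indep J}"] by auto
  define I where "I = (UNIV :: 'b set) <+> J"
  have card_I: "card I \<le> CARD('a)"
  proof (rule ccontr)
    assume "\<not> card I \<le> CARD('a)"
    then have "card (vcoords :: (complex^'a \<Rightarrow> complex) set) < card I"
      using card_vcoords[where 'a = 'a] by linarith
    then show False
      using exists_polynomial_relation[of I vcoords g] g J
      by (auto simp: I_def indep_def algebraically_independent_def)
  qed
  have "\<forall>i\<in>-J. \<exists>d c. (\<forall>j. poly_alg (g ` I) (c j)) \<and> (\<forall>p. (\<Sum>j\<le>d::nat. c j p * p $ i ^ j) = 0) \<and>
    (\<exists>p. (\<Sum>j\<le>d. c j p * (of_nat j * p $ i ^ (j - 1))) \<noteq> 0)"
  proof
    fix i assume "i \<in> -J"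
    then have "\<not> indep (insert i J)" using J_max[of "insert i J"] by auto
    moreover have "UNIV <+> insert i J = insert (Inr i) I" by (auto simp: I_def)
    ultimately have "\<not> algebraically_independent (insert (Inr i) I) g" by (simp add: indep_def)
    moreover have "algebraically_independent I g" using J by (simp add: indep_def I_def)
    ultimately show "\<exists>d c. (\<forall>j. poly_alg (g ` I) (c j)) \<and> (\<forall>p. (\<Sum>j\<le>d::nat. c j p * p $ i ^ j) = 0) \<and>
        (\<exists>p. (\<Sum>j\<le>d. c j p * (of_nat j * p $ i ^ (j - 1))) \<noteq> 0)"
      using separable_relation[OF algebraic_of_dependent_insert[of I g "Inr i"]] by (simp add: g_def)
  qed
  from bchoice[OF this] obtain d where "\<forall>i\<in>-J. \<exists>c. (\<forall>j. poly_alg (g ` I) (c j)) \<and>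
    (\<forall>p. (\<Sum>j\<le>d i. c j p * p $ i ^ j) = 0) \<and> (\<exists>p. (\<Sum>j\<le>d i. c j p * (of_nat j * p $ i ^ (j - 1))) \<noteq> 0)"
    by blast
  from bchoice[OF this] obtain c where c: "\<And>i j. i \<notin> J \<Longrightarrow> poly_alg (g ` I) (c i j)"
    "\<And>i p. i \<notin> J \<Longrightarrow> (\<Sum>j\<le>d i. c i j p * p $ i ^ j) = 0"
    "\<And>i. i \<notin> J \<Longrightarrow> \<exists>p. (\<Sum>j\<le>d i. c i j p * (of_nat j * p $ i ^ (j - 1))) \<noteq> 0"
    by blast
  define e where "e i p = (\<Sum>j\<le>d i. c i j p * (of_nat j * p $ i ^ (j - 1)))" for i p
  have "\<exists>p\<in>UNIV. \<forall>i\<in>-J. e i p \<noteq> 0"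
  proof (rule poly_alg_common_nonzero)
    fix i assume i: "i \<in> -J"
    have "poly_alg vcoords (c i j)" for j
    proof (rule poly_alg_trans)
      show "poly_alg (g ` I) (c i j)" using c(1) i by blast
    qed (use g in blast)
    then show "poly_alg vcoords (e i)"
      unfolding e_def by (intro poly_alg_intros poly_alg_vcoord)
    show "\<exists>p. e i p \<noteq> 0" using c(3) i by (simp add: e_def)
  qed auto
  then obtain p where p: "\<And>i. i \<notin> J \<Longrightarrow> e i p \<noteq> 0" by auto
  have ker: "v = 0" if v: "\<And>k. k \<in> I \<Longrightarrow> dg p k v = 0" for v
  proof -
    have "v $ i = 0" for i
    proof (cases "i \<in> J")
      case True
      then show ?thesis using v[of "Inr i"] by (auto simp: I_def dg_def)
    next
      case False
      have "\<forall>j. \<exists>c'. (c i j has_derivative c') (at p) \<and> c' v = 0"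
        using poly_alg_derivative_kernel[OF c(1)[OF False]] dg v by blast
      from choice[OF this] obtain c' where c': "\<And>j. (c i j has_derivative c' j) (at p)" "\<And>j. c' j v = 0"
        by blast
      have "((\<lambda>x. \<Sum>j\<le>d i. c i j x * x $ i ^ j) has_derivative
          (\<lambda>h. \<Sum>j\<le>d i. c i j p * (of_nat j * h $ i * p $ i ^ (j - 1)) + c' j h * p $ i ^ j)) (at p)"
        by (intro has_derivative_sum has_derivative_mult c' has_derivative_power
            bounded_linear_imp_has_derivative bounded_linear_vec_nth)
      moreover have "((\<lambda>x. \<Sum>j\<le>d i. c i j x * x $ i ^ j) has_derivative (\<lambda>h. 0)) (at p)"
        using c(2)[OF False] by simp
      ultimately have "(\<lambda>h. \<Sum>j\<le>d i. c i j p * (of_nat j * h $ i * p $ i ^ (j - 1)) + c' j h * p $ i ^ j)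
          = (\<lambda>h. 0)"
        by (rule has_derivative_unique)
      from fun_cong[OF this, of v]
      have "(\<Sum>j\<le>d i. c i j p * (of_nat j * v $ i * p $ i ^ (j - 1)) + c' j v * p $ i ^ j) = 0" .
      moreover have "e i p * v $ i =
          (\<Sum>j\<le>d i. c i j p * (of_nat j * v $ i * p $ i ^ (j - 1)) + c' j v * p $ i ^ j)"
        unfolding e_def sum_distrib_right by (rule sum.cong) (simp_all add: c'(2))
      ultimately have "e i p * v $ i = 0" by simp
      then show ?thesis using p[OF False] by simp
    qed
    then show ?thesis by (simp add: vec_eq_iff)
  qed
  \<comment> \<open>The differentials of the family are placed into distinct coordinates of \<open>complex^'a\<close>, and the
    remaining coordinates are filled with zeros: an endomorphism for which injectivity gives
    surjectivity.\<close>
  obtain \<sigma> :: "'b + 'a \<Rightarrow> 'a" where \<sigma>: "inj_on \<sigma> I"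
    using card_le_inj[of I "UNIV :: 'a set"] card_I by auto
  define T where "T v = (\<chi> k. if k \<in> \<sigma> ` I then dg p (inv_into I \<sigma> k) v else 0)" for v
  have T_nth: "T v $ \<sigma> k = dg p k v" if "k \<in> I" for k v
    using that \<sigma> by (simp add: T_def inv_into_f_f)
  have dg_linear: "linear (dg p k)" for k
    using dg has_derivative_linear by blast
  have "linear T"
    by (rule linearI) (auto simp: T_def vec_eq_iff linear_add[OF dg_linear] linear_scale[OF dg_linear])
  moreover have "inj T"
  proof (rule linear_injective_0[OF \<open>linear T\<close>, THEN iffD2], intro allI impI)
    fix v assume "T v = 0"
    then have "dg p k v = 0" if "k \<in> I" for k using T_nth[OF that, of v] by simp
    then show "v = 0" by (rule ker)
  qed
  ultimately have "surj T" using linear_injective_imp_surjective by blast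
  have "surj ((*v) (M p))" unfolding surj_def
  proof
    fix y :: "complex^'b"
    obtain v where v: "(\<chi> k. if k \<in> \<sigma> ` I then case_sum (($) y) (\<lambda>_. 0) (inv_into I \<sigma> k) else 0) = T v"
      using surjD[OF \<open>surj T\<close>] by blast
    have "y $ i = (M p *v v) $ i" for i
    proof -
      have i: "Inl i \<in> I" by (auto simp: I_def)
      have "(\<chi> k. if k \<in> \<sigma> ` I then case_sum (($) y) (\<lambda>_. 0) (inv_into I \<sigma> k) else 0) $ \<sigma> (Inl i) = y $ i"
        using i \<sigma> by (simp add: inv_into_f_f)
      then show ?thesis using T_nth[OF i, of v] v by (simp add: dg_def)
    qed
    then show "\<exists>v. y = M p *v v" by (intro exI[of _ v]) (simp add: vec_eq_iff)
  qed
  then show ?thesis using M by blast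
qed

theorem dense_range_iff_surjective_derivative:
  fixes F :: "complex^'a \<Rightarrow> complex^'b"
  assumes "\<And>i. poly_alg vcoords (\<lambda>x. F x $ i)"
  shows "closure (range F) = UNIV \<longleftrightarrow> (\<exists>p F'. (F has_derivative F') (at p) \<and> surj F')"
  using exists_surjective_derivative[OF assms] dense_range_of_surjective_derivative[OF assms] by blast

section \<open>The product map of two matrix subspaces\<close>

lemma exists_complex_projection:
  fixes V :: "(complex^'n^'n) set"
  assumes V: "cmat.subspace V"
  shows "\<exists>\<pi>. (\<forall>A B. \<pi> (A + B) = \<pi> A + \<pi> B) \<and> (\<forall>c A. \<pi> (cscale c A) = cscale c (\<pi> A)) \<and>
    (\<forall>A. \<pi> A \<in> V) \<and> (\<forall>A\<in>V. \<pi> A = A)"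
proof -
  interpret pair: vector_space_pair
    "cscale :: complex \<Rightarrow> complex^'n^'n \<Rightarrow> _" "cscale :: complex \<Rightarrow> complex^'n^'n \<Rightarrow> _"
    by unfold_locales
  obtain B where B: "B \<subseteq> V" "cmat.independent B" "V \<subseteq> cmat.span B"
    using cmat.maximal_independent_subset[of V] by blast
  have span: "cmat.span B = V"
    using B(1,3) cmat.span_minimal[OF B(1) V] by blast
  obtain \<pi> where \<pi>: "Vector_Spaces.linear cscale cscale \<pi>" "\<forall>x\<in>B. \<pi> x = id x"
    "range \<pi> = cmat.span (id ` B)"
    using pair.linear_independent_extend_subspace[OF B(2), of id] by blast
  interpret \<pi>: Vector_Spaces.linear cscale cscale \<pi> by (rule \<pi>(1))
  have "\<pi> A = A" if "A \<in> V" for A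
    using that unfolding span[symmetric]
    by (induction rule: cmat.span_induct_alt) (use \<pi>(2) in \<open>auto simp: \<pi>.add \<pi>.scale \<pi>.zero\<close>)
  moreover have "\<pi> A \<in> V" for A using \<pi>(3) span by auto
  ultimately show ?thesis using \<pi>.add \<pi>.scale by blast
qed

definition matrix_unit :: "'n \<Rightarrow> 'n \<Rightarrow> complex^'n^'n"
  where "matrix_unit i j = (\<chi> k l. if k = i \<and> l = j then 1 else 0)"

lemma matrix_unit_expansion: "A = (\<Sum>i\<in>UNIV. \<Sum>j\<in>UNIV. cscale (A $ i $ j) (matrix_unit i j))"
proof -
  have "(\<Sum>i\<in>UNIV. \<Sum>j\<in>UNIV. A $ i $ j * (if k = i \<and> l = j then 1 else 0)) = A $ k $ l" for k l
  proof -
    have "(\<Sum>i\<in>UNIV. \<Sum>j\<in>UNIV. A $ i $ j * (if k = i \<and> l = j then 1 else 0)) =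
        (\<Sum>i\<in>UNIV. \<Sum>j\<in>UNIV. if j = l then (if i = k then A $ i $ j else 0) else 0)"
      by (intro sum.cong refl) auto
    then show ?thesis by simp
  qed
  then show ?thesis by (simp add: vec_eq_iff cscale_def matrix_unit_def)
qed

lemma poly_alg_complex_linear:
  fixes \<pi> :: "complex^'n^'n \<Rightarrow> complex^'n^'n"
  assumes add: "\<And>A B. \<pi> (A + B) = \<pi> A + \<pi> B" and scale: "\<And>c A. \<pi> (cscale c A) = cscale c (\<pi> A)"
    and X: "\<And>i j. poly_alg H (\<lambda>u. X u $ i $ j)"
  shows "poly_alg H (\<lambda>u. \<pi> (X u) $ k $ l)"
proof -
  have zero: "\<pi> 0 = 0" using add[of 0 0] by simp
  have sum: "\<pi> (\<Sum>i\<in>S. f i) = (\<Sum>i\<in>S. \<pi> (f i))" for f and S :: "'n set"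
    by (induction S rule: infinite_finite_induct) (simp_all add: zero add)
  have expand: "\<pi> A = (\<Sum>i\<in>UNIV. \<Sum>j\<in>UNIV. cscale (A $ i $ j) (\<pi> (matrix_unit i j)))" for A
    using arg_cong[OF matrix_unit_expansion[of A], of \<pi>] by (simp only: sum scale)
  have "\<pi> (X u) $ k $ l = (\<Sum>i\<in>UNIV. \<Sum>j\<in>UNIV. X u $ i $ j * \<pi> (matrix_unit i j) $ k $ l)" for u
    by (subst expand) (simp add: cscale_def)
  then show ?thesis by (simp only:) (intro poly_alg_intros X)
qed

lemma scaleR_eq_cscale: "r *\<^sub>R A = cscale (of_real r) A"
  by (simp add: cscale_def vec_eq_iff complex_eq_iff)

lemma bounded_linear_complex_linear:
  fixes \<pi> :: "complex^'n^'n \<Rightarrow> complex^'n^'n"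
  assumes add: "\<And>A B. \<pi> (A + B) = \<pi> A + \<pi> B" and scale: "\<And>c A. \<pi> (cscale c A) = cscale c (\<pi> A)"
  shows "bounded_linear \<pi>"
  unfolding linear_conv_bounded_linear[symmetric]
  by (rule linearI) (simp_all add: add scale scaleR_eq_cscale)

lemma closed_complex_subspace:
  fixes S :: "(complex^'n^'n) set"
  assumes "cmat.subspace S" shows "closed S"
proof -
  have "subspace S"
    using assms unfolding subspace_def cmat.subspace_def scaleR_eq_cscale by blast
  then show ?thesis by (rule closed_subspace)
qed

lemma bounded_bilinear_matrix_mult: "bounded_bilinear ((**) :: complex^'n^'n \<Rightarrow> _ \<Rightarrow> _)"
  unfolding bilinear_conv_bounded_bilinear[symmetric] bilinear_def
  by (auto intro!: linearI simp: vec_eq_iff matrix_matrix_mult_def sum.distrib ring_distribs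
      scaleR_sum_right)

text \<open>
  The criterion for polynomial maps concerns maps between full coordinate spaces. Complex linear
  projections \<open>\<pi>1\<close>, \<open>\<pi>2\<close> onto \<open>\<V>1\<close>, \<open>\<V>2\<close> parametrize the factors by all matrices. The target
  is the linearization \<open>L\<close>, a proper subspace in general; a third matrix, projected to a complement
  of \<open>L\<close>, is added to fill up the whole space. Applying the projection \<open>\<pi>\<close> onto \<open>L\<close> removes this
  summand again, both from the range and from the image of the derivative.
\<close>

lemma dense_products_iff:
  fixes \<V>1 \<V>2 :: "(complex^'n^'n) set"
  assumes \<V>1: "cmat.subspace \<V>1" and \<V>2: "cmat.subspace \<V>2"
  defines "S \<equiv> set_of_products \<V>1 \<V>2"
  shows "closure S = linearization S \<longleftrightarrow>
    (\<exists>V1\<in>\<V>1. \<exists>V2\<in>\<V>2. linearization S \<subseteq> deriv_image \<V>1 \<V>2 V1 V2)"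
proof -
  define L where "L = linearization S"
  have L: "cmat.subspace L" by (simp add: L_def linearization_eq_span cmat.subspace_span)
  have S_L: "S \<subseteq> L" by (simp add: L_def linearization_eq_span cmat.span_superset)
  have prod_L: "A ** B \<in> L" if "A \<in> \<V>1" "B \<in> \<V>2" for A B
    using that S_L by (auto simp: S_def set_of_products_def)
  obtain \<pi>1 where \<pi>1: "\<And>A B. \<pi>1 (A + B) = \<pi>1 A + \<pi>1 B" "\<And>c A. \<pi>1 (cscale c A) = cscale c (\<pi>1 A)"
    "\<And>A. \<pi>1 A \<in> \<V>1" "\<And>A. A \<in> \<V>1 \<Longrightarrow> \<pi>1 A = A"
    using exists_complex_projection[OF \<V>1] by blast
  obtain \<pi>2 where \<pi>2: "\<And>A B. \<pi>2 (A + B) = \<pi>2 A + \<pi>2 B" "\<And>c A. \<pi>2 (cscale c A) = cscale c (\<pi>2 A)"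
    "\<And>A. \<pi>2 A \<in> \<V>2" "\<And>A. A \<in> \<V>2 \<Longrightarrow> \<pi>2 A = A"
    using exists_complex_projection[OF \<V>2] by blast
  obtain \<pi> where \<pi>: "\<And>A B. \<pi> (A + B) = \<pi> A + \<pi> B" "\<And>c A. \<pi> (cscale c A) = cscale c (\<pi> A)"
    "\<And>A. \<pi> A \<in> L" "\<And>A. A \<in> L \<Longrightarrow> \<pi> A = A"
    using exists_complex_projection[OF L] by blast
  note bl = bounded_linear_complex_linear[OF \<pi>1(1,2)] bounded_linear_complex_linear[OF \<pi>2(1,2)]
    bounded_linear_complex_linear[OF \<pi>(1,2)]
  have \<pi>_diff: "\<pi> (A - B) = \<pi> A - \<pi> B" for A B
    using bl(3) by (simp add: linear_diff bounded_linear.linear)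
  have \<pi>_compl: "\<pi> (A - \<pi> A) = 0" for A
    by (simp add: \<pi>_diff \<pi>(3,4))
  define vec :: "complex^'n^'n \<Rightarrow> complex^('n \<times> 'n)" where "vec A = (\<chi> k. A $ fst k $ snd k)" for A
  define unvec :: "complex^('n \<times> 'n) \<Rightarrow> complex^'n^'n" where "unvec z = (\<chi> i j. z $ (i, j))" for z
  have unvec_vec: "unvec (vec A) = A" and vec_unvec: "vec (unvec z) = z" for A z
    by (simp_all add: vec_def unvec_def vec_eq_iff)
  have bl_vec: "bounded_linear vec" "bounded_linear unvec"
    unfolding linear_conv_bounded_linear[symmetric]
    by (auto intro!: linearI simp: vec_def unvec_def vec_eq_iff)
  define M1 :: "complex^('n \<times> 'n + 'n \<times> 'n + 'n \<times> 'n) \<Rightarrow> complex^'n^'n"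
    where "M1 u = (\<chi> i j. u $ Inl (i, j))" for u
  define M2 :: "complex^('n \<times> 'n + 'n \<times> 'n + 'n \<times> 'n) \<Rightarrow> complex^'n^'n"
    where "M2 u = (\<chi> i j. u $ Inr (Inl (i, j)))" for u
  define M3 :: "complex^('n \<times> 'n + 'n \<times> 'n + 'n \<times> 'n) \<Rightarrow> complex^'n^'n"
    where "M3 u = (\<chi> i j. u $ Inr (Inr (i, j)))" for u
  define mk where "mk A B C = (\<chi> k. case k of Inl (i, j) \<Rightarrow> A $ i $ j
    | Inr (Inl (i, j)) \<Rightarrow> B $ i $ j | Inr (Inr (i, j)) \<Rightarrow> C $ i $ j)" for A B C :: "complex^'n^'n"
  have mk: "M1 (mk A B C) = A" "M2 (mk A B C) = B" "M3 (mk A B C) = C" for A B C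
    by (simp_all add: M1_def M2_def M3_def mk_def vec_eq_iff)
  have bl_M: "bounded_linear M1" "bounded_linear M2" "bounded_linear M3"
    unfolding linear_conv_bounded_linear[symmetric]
    by (auto intro!: linearI simp: M1_def M2_def M3_def vec_eq_iff)
  define A1 where "A1 u = \<pi>1 (M1 u)" for u
  define A2 where "A2 u = \<pi>2 (M2 u)" for u
  define A3 where "A3 u = M3 u - \<pi> (M3 u)" for u
  have bl_A: "bounded_linear A1" "bounded_linear A2" "bounded_linear A3"
    unfolding A1_def[abs_def] A2_def[abs_def] A3_def[abs_def]
    using bounded_linear_compose[OF bl(1) bl_M(1)] bounded_linear_compose[OF bl(2) bl_M(2)]
      bounded_linear_sub[OF bl_M(3) bounded_linear_compose[OF bl(3) bl_M(3)]] by simp_all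
  have A_mem: "A1 u \<in> \<V>1" "A2 u \<in> \<V>2" "\<pi> (A3 u) = 0" for u
    by (simp_all add: A1_def A2_def A3_def \<pi>1(3) \<pi>2(3) \<pi>_compl)
  define F where "F u = vec (A1 u ** A2 u + A3 u)" for u
  have F_poly: "poly_alg vcoords (\<lambda>u. F u $ k)" for k
  proof -
    have "poly_alg vcoords (\<lambda>u. A1 u $ i $ j)" for i j
      unfolding A1_def by (rule poly_alg_complex_linear[OF \<pi>1(1,2)]) (simp add: M1_def poly_alg_vcoord)
    moreover have "poly_alg vcoords (\<lambda>u. A2 u $ i $ j)" for i j
      unfolding A2_def by (rule poly_alg_complex_linear[OF \<pi>2(1,2)]) (simp add: M2_def poly_alg_vcoord)
    moreover have M3: "poly_alg vcoords (\<lambda>u. M3 u $ i $ j)" for i j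
      by (simp add: M3_def poly_alg_vcoord)
    moreover have "poly_alg vcoords (\<lambda>u. \<pi> (M3 u) $ i $ j)" for i j
      by (rule poly_alg_complex_linear[OF \<pi>(1,2) M3])
    ultimately show ?thesis
      unfolding F_def vec_def A3_def
      by (simp add: matrix_matrix_mult_def) (intro poly_alg_intros)
  qed
  define F' where "F' u h = vec (A1 u ** A2 h + A1 h ** A2 u + A3 h)" for u h
  have F': "(F has_derivative F' u) (at u)" for u
    unfolding F_def[abs_def] F'_def[abs_def]
    by (intro bounded_linear.has_derivative[OF bl_vec(1)] has_derivative_add
        bounded_bilinear.FDERIV[OF bounded_bilinear_matrix_mult] bounded_linear_imp_has_derivative bl_A)
  have image_L: "deriv_image \<V>1 \<V>2 V1 V2 \<subseteq> L" if "V1 \<in> \<V>1" "V2 \<in> \<V>2" for V1 V2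
    using that prod_L cmat.subspace_add[OF L] by (auto simp: deriv_image_def)
  have surj_iff: "(\<exists>u. surj (F' u)) \<longleftrightarrow> (\<exists>V1\<in>\<V>1. \<exists>V2\<in>\<V>2. L \<subseteq> deriv_image \<V>1 \<V>2 V1 V2)"
  proof
    assume "\<exists>u. surj (F' u)"
    then obtain u where u: "surj (F' u)" by blast
    have "z \<in> deriv_image \<V>1 \<V>2 (A1 u) (A2 u)" if z: "z \<in> L" for z
    proof -
      obtain h where h: "vec z = F' u h" using surjD[OF u] by blast
      define y where "y = A1 u ** A2 h + A1 h ** A2 u"
      have y: "y \<in> deriv_image \<V>1 \<V>2 (A1 u) (A2 u)"
        using A_mem unfolding y_def deriv_image_def by blast
      have "z = y + A3 h" using arg_cong[OF h, of unvec] by (simp add: F'_def unvec_vec y_def)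
      then have "\<pi> z = \<pi> y" by (simp add: \<pi>(1) A_mem)
      moreover have "y \<in> L" using y image_L[OF A_mem(1,2)] by blast
      ultimately show ?thesis using y z \<pi>(4) by simp
    qed
    then show "\<exists>V1\<in>\<V>1. \<exists>V2\<in>\<V>2. L \<subseteq> deriv_image \<V>1 \<V>2 V1 V2" using A_mem by blast
  next
    assume "\<exists>V1\<in>\<V>1. \<exists>V2\<in>\<V>2. L \<subseteq> deriv_image \<V>1 \<V>2 V1 V2"
    then obtain V1 V2 where V: "V1 \<in> \<V>1" "V2 \<in> \<V>2" "L \<subseteq> deriv_image \<V>1 \<V>2 V1 V2" by blast
    have "\<exists>h. y = F' (mk V1 V2 0) h" for y
    proof -
      obtain W1 W2 where W: "W1 \<in> \<V>1" "W2 \<in> \<V>2" "\<pi> (unvec y) = V1 ** W2 + W1 ** V2"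
        using V(3) \<pi>(3)[of "unvec y"] by (auto simp: deriv_image_def)
      have "F' (mk V1 V2 0) (mk W1 W2 (unvec y)) = vec (V1 ** W2 + W1 ** V2 + (unvec y - \<pi> (unvec y)))"
        using V W by (simp add: F'_def A1_def A2_def A3_def mk \<pi>1(4) \<pi>2(4))
      also have "\<dots> = y" by (simp add: W(3)[symmetric] vec_unvec)
      finally show ?thesis by metis
    qed
    then show "\<exists>u. surj (F' u)" unfolding surj_def by blast
  qed
  have dense_iff: "closure (range F) = UNIV \<longleftrightarrow> closure S = L"
  proof
    assume dense: "closure (range F) = UNIV"
    have "continuous_on (closure (range F)) (\<lambda>z. \<pi> (unvec z))"
      by (rule linear_continuous_on) (rule bounded_linear_compose[OF bl(3) bl_vec(2)])
    moreover have "\<pi> (unvec (F u)) \<in> S" for u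
      using A_mem[of u] prod_L by (auto simp: F_def unvec_vec \<pi>(1) \<pi>(4) S_def set_of_products_def)
    then have "(\<lambda>z. \<pi> (unvec z)) ` range F \<subseteq> closure S" using closure_subset by blast
    ultimately have "(\<lambda>z. \<pi> (unvec z)) ` closure (range F) \<subseteq> closure S"
      by (rule image_closure_subset[OF _ closed_closure])
    then have "\<pi> (unvec (vec z)) \<in> closure S" for z using dense by blast
    then have "L \<subseteq> closure S" using \<pi>(4) by (metis unvec_vec subsetI)
    moreover have "closure S \<subseteq> L" by (rule closure_minimal[OF S_L closed_complex_subspace[OF L]])
    ultimately show "closure S = L" by blast
  next
    assume cl: "closure S = L"
    have "y \<in> closure (range F)" for y
    proof -
      define Y where "Y = unvec y"
      have "continuous_on (closure S) (\<lambda>X. vec (X + (Y - \<pi> Y)))"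
        by (intro bounded_linear.continuous_on[OF bl_vec(1)] continuous_intros)
      moreover have "(\<lambda>X. vec (X + (Y - \<pi> Y))) ` S \<subseteq> closure (range F)"
      proof -
        have "vec (A ** B + (Y - \<pi> Y)) = F (mk A B Y)" if "A \<in> \<V>1" "B \<in> \<V>2" for A B
          using that by (simp add: F_def A1_def A2_def A3_def mk \<pi>1(4) \<pi>2(4))
        then have "(\<lambda>X. vec (X + (Y - \<pi> Y))) ` S \<subseteq> range F"
          by (auto simp: S_def set_of_products_def)
        then show ?thesis using closure_subset by blast
      qed
      ultimately have "(\<lambda>X. vec (X + (Y - \<pi> Y))) ` closure S \<subseteq> closure (range F)"
        by (rule image_closure_subset[OF _ closed_closure])
      then have "vec (\<pi> Y + (Y - \<pi> Y)) \<in> closure (range F)" using cl \<pi>(3) by blast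
      then show ?thesis by (simp add: Y_def vec_unvec)
    qed
    then show "closure (range F) = UNIV" by blast
  qed
  have "(\<exists>p D. (F has_derivative D) (at p) \<and> surj D) \<longleftrightarrow> (\<exists>u. surj (F' u))"
    using F' has_derivative_unique by blast
  then show ?thesis
    using dense_iff surj_iff dense_range_iff_surjective_derivative[of F, OF F_poly] by (simp add: L_def)
qed

lemma orth_proj_eq_self_iff:
  fixes S :: "(complex^'n^'n) set"
  assumes "cmat.subspace S" shows "orth_proj S A = A \<longleftrightarrow> A \<in> S"
proof
  assume "orth_proj S A = A"
  then show "A \<in> S"
    using theI'[OF orth_proj_exists_unique[OF assms, of A]] by (simp add: orth_proj_def)
next
  assume "A \<in> S"
  then have "A \<in> S \<and> (\<forall>B\<in>S. cmat_inner (A - A) B = 0)"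
    by (simp add: cmat_inner_def trace_def matrix_matrix_mult_def)
  then show "orth_proj S A = A"
    unfolding orth_proj_def by (rule the1_equality[OF orth_proj_exists_unique[OF assms]])
qed

text \<open>
  Monotonicity of \<open>cmat.dim\<close> needs a finite spanning set, for which the matrix units serve; without one,
  the dimension of a subspace could be the default value zero of an infinite basis.
\<close>

lemma cmat_dim_mono:
  fixes S T :: "(complex^'n^'n) set"
  assumes "S \<subseteq> T" shows "cmat.dim S \<le> cmat.dim T"
proof -
  define E where "E = (\<lambda>(i, j). matrix_unit i j :: complex^'n^'n) ` UNIV"
  have "A \<in> cmat.span E" for A
    by (subst matrix_unit_expansion)
      (intro cmat.span_sum cmat.span_scale cmat.span_base, auto simp: E_def)
  then have "UNIV \<subseteq> cmat.span E" by blast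
  obtain B where B: "B \<subseteq> T" "cmat.independent B" "T \<subseteq> cmat.span B" "card B = cmat.dim T"
    using cmat.basis_exists by blast
  have "finite B"
    using cmat.independent_span_bound[of E B] B(2) \<open>UNIV \<subseteq> cmat.span E\<close> by (auto simp: E_def)
  then show ?thesis using cmat.dim_le_card[of S B] assms B(3,4) by auto
qed

theorem theorem3p7:
  fixes \<V>1 \<V>2 :: "(complex^'n^'n) set"
  assumes "cmat.subspace \<V>1" and "cmat.subspace \<V>2"
  shows "closure (set_of_products \<V>1 \<V>2) = linearization (set_of_products \<V>1 \<V>2) \<longleftrightarrow>
    (\<exists>V1\<in>\<V>1. \<exists>V2\<in>\<V>2.
      (\<forall>U1\<in>\<V>1. \<forall>U2\<in>\<V>2. Psi_rank \<V>1 \<V>2 U1 U2 \<le> Psi_rank \<V>1 \<V>2 V1 V2) \<and>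
      (\<forall>W1\<in>\<V>1. \<forall>W2\<in>\<V>2. Q_map \<V>1 \<V>2 V1 V2 W1 W2 = 0))"
proof -
  define S where "S = set_of_products \<V>1 \<V>2"
  have Q: "(\<forall>W1\<in>\<V>1. \<forall>W2\<in>\<V>2. Q_map \<V>1 \<V>2 V1 V2 W1 W2 = 0) \<longleftrightarrow>
      linearization S \<subseteq> deriv_image \<V>1 \<V>2 V1 V2" for V1 V2
  proof -
    let ?D = "deriv_image \<V>1 \<V>2 V1 V2"
    have D: "cmat.subspace ?D" by (rule subspace_deriv_image[OF assms])
    have "Q_map \<V>1 \<V>2 V1 V2 W1 W2 = 0 \<longleftrightarrow> W1 ** W2 \<in> ?D" for W1 W2
      unfolding Q_map_def using orth_proj_eq_self_iff[OF D, of "W1 ** W2"] by auto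
    then have "(\<forall>W1\<in>\<V>1. \<forall>W2\<in>\<V>2. Q_map \<V>1 \<V>2 V1 V2 W1 W2 = 0) \<longleftrightarrow> S \<subseteq> ?D"
      by (fastforce simp: S_def set_of_products_def)
    also have "\<dots> \<longleftrightarrow> linearization S \<subseteq> ?D"
      unfolding linearization_eq_span
      using cmat.span_minimal[OF _ D] cmat.span_superset by blast
    finally show ?thesis .
  qed
  have image: "deriv_image \<V>1 \<V>2 U1 U2 \<subseteq> linearization S" if "U1 \<in> \<V>1" "U2 \<in> \<V>2" for U1 U2
  proof -
    have "A ** B \<in> cmat.span S" if "A \<in> \<V>1" "B \<in> \<V>2" for A B
      using that by (intro cmat.span_base) (auto simp: S_def set_of_products_def)
    then show ?thesis
      using that by (auto simp: deriv_image_def linearization_eq_span intro!: cmat.span_add)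
  qed
  have "Psi_rank \<V>1 \<V>2 U1 U2 \<le> Psi_rank \<V>1 \<V>2 V1 V2"
    if "linearization S \<subseteq> deriv_image \<V>1 \<V>2 V1 V2" "U1 \<in> \<V>1" "U2 \<in> \<V>2" for U1 U2 V1 V2
    unfolding Psi_rank_def using image[OF that(2,3)] that(1) by (intro cmat_dim_mono) blast
  then show ?thesis
    using dense_products_iff[OF assms] Q unfolding S_def by blast
qed

end
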